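(* Let $\mathcal{T}^\ell$ represent $\ell$ iterations of the accelerated projected gradient method, and consider the optimizer dynamics $z_k=\mathcal{T}^\ell(z_{k-1},x_k)$, $k\ge1$, driven by a sequence $\{x_k\}_{k\ge0}\subset\mathbb{R}^n$, with $z_0\in\mathcal{Z}$. Provided that $$\ell>\bar\ell=1-\frac{\log(\kappa(H))}{\log(1-1/\sqrt{\kappa(H)})},$$ the error signal $e_k=z_k-S(x_k)$ is input-to-state stable with respect to the state update $\Delta x_k=x_{k+1}-x_k$, i.e., for all $k\ge0$, $$\|e_k\|_H\le\eta_a(\ell)^k\,\|e_0\|_H+\gamma_2^a(\ell)\,\sup_{k\ge0}\|G\Delta x_k\|_{H^{-1}},$$ where $\gamma_2^a(\ell)=\eta_a(\ell)/(1-\eta_a(\ell))$ and $\eta_a(\ell)=\sqrt{\kappa(H)}\left(1-\kappa(H)^{-1/2}\right)^{\frac{\ell-1}{2}}$. Moreover, $$\limsup_{k\to\infty}\|e_k\|_H\le\gamma_2^a(\ell)\,\limsup_{k\to\infty}\|G\Delta x_k\|_{H^{-1}} .$$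
   Context: Notation: $\mathbb{S}_{++}^d$ is the set of symmetric positive definite $d\times d$ real matrices; $\|x\|_M=\sqrt{x^TMx}$; $\lambda^-(H),\lambda^+(H)$ are the minimum and maximum eigenvalues and $\kappa(H)=\lambda^+(H)/\lambda^-(H)$; $(x,y)$ denotes the stacked vector. The iteration count $\ell$ is a positive integer. (The paper writes $\eta_a\in\mathcal{L}$, i.e. $\eta_a$ is a function decreasing to zero.) Setting: $n,m,N\ge1$ are integers, $A\in\mathbb{R}^{n\times n}$, $B\in\mathbb{R}^{n\times m}$. Standing assumptions: (1) $(A,B)$ is stabilizable, $R\in\mathbb{S}_{++}^m$, $Q\in\mathbb{S}_{++}^n$, and $P\in\mathbb{S}_{++}^n$ satisfies $P=Q+A^TPA-(A^TPB)(R+B^TPB)^{-1}(B^TPA)$; (2) $\mathcal{U}\subseteq\mathbb{R}^m$ is closed, convex and contains the origin in its interior. Let $\hat A\in\mathbb{R}^{(N+1)n\times n}$ be the block column with blocks $I,A,\dots,A^N$; let $\hat B\in\mathbb{R}^{(N+1)n\times Nm}$ be the block matrix whose block $(i,j)$, $i=0,\dots,N$, $j=0,\dots,N-1$, is $A^{i-1-j}B$ if $j\le i-1$ and $0$ otherwise; $\hat H=\mathrm{blkdiag}(I_N\otimes Q,\,P)$. Set $H=\hat B^T\hat H\hat B+I_N\otimes R$, $G=\hat B^T\hat H\hat A$, $W=\hat A^T\hat H\hat A$, $M=\begin{bmatrix}H&G\\ G^T&W\end{bmatrix}$. Let $\mathcal{Z}=\mathcal{U}\times\cdots\times\mathcal{U}$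 ($N$ copies), $f(z,x)=\|(z,x)\|_M^2$, and let $S(x)$ be the unique minimizer of $f(\cdot,x)$ over $\mathcal{Z}$. Accelerated projected gradient method: given $z\in\mathcal{Z}$, $x\in\mathbb{R}^n$ and an integer $\ell>0$, put $\mathsf{m}=2\lambda^-(H)$, $L=2\lambda^+(H)$, $\kappa=L/\mathsf{m}$, $\theta_0=1$, $\theta_{-1}=0$, $z_0=v_0=z$, and for $k=0,\dots,\ell-1$: $\gamma_k=\theta_{k-1}^2L$, $y_k=z_k+\frac{\theta_k\gamma_k}{\gamma_k+\mathsf{m}\theta_k}(v_k-z_k)$, $z_{k+1}=\Pi_{\mathcal{Z}}[y_k-L^{-1}\nabla_zf(y_k,x)]$, $v_{k+1}=z_k+\theta_k^{-1}(z_{k+1}-z_k)$, $\zeta_k=\theta_k^2-\kappa^{-1}$, $\theta_{k+1}=\frac{\zeta_k}{2}\left(\sqrt{1+4\theta_k^2/\zeta_k^2}-1\right)$. Here $\Pi_{\mathcal{Z}}$ is Euclidean projection onto $\mathcal{Z}$. The output is $\mathcal{T}^\ell(z,x)=z_\ell$ (the indices inside the algorithm are internal to each call). *)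

theory Defs
  imports "HOL-Analysis.Analysis"
begin

text \<open>The dimensions n, m and the horizon N are the cardinalities of finite index types 'n, 'm, 'h.
  The type 'h is linearly ordered; its elements enumerate the stages 0, ..., N-1 in increasing
  order. The type 'h option enumerates the times 0, ..., N, with None as the terminal time N.
  A stacked vector in R^(Nm) is indexed by pairs (stage, component), and likewise for R^((N+1)n).\<close>

subsection \<open>Matrices\<close>

definition wnorm :: "real^'n^'n \<Rightarrow> real^'n \<Rightarrow> real" where
  "wnorm M x = sqrt (x \<bullet> (M *v x))"

definition spd :: "real^'n^'n \<Rightarrow> bool" where
  "spd M \<longleftrightarrow> transpose M = M \<and> (\<forall>x. x \<noteq> 0 \<longrightarrow> 0 < x \<bullet> (M *v x))"

definition eigenvalue :: "real^'n^'n \<Rightarrow> real \<Rightarrow> bool" where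
  "eigenvalue M c \<longleftrightarrow> (\<exists>v. v \<noteq> 0 \<and> M *v v = c *\<^sub>R v)"

definition lam_min :: "real^'n^'n \<Rightarrow> real" where
  "lam_min M = Min {c. eigenvalue M c}"

definition lam_max :: "real^'n^'n \<Rightarrow> real" where
  "lam_max M = Max {c. eigenvalue M c}"

definition kappa :: "real^'n^'n \<Rightarrow> real" where
  "kappa M = lam_max M / lam_min M"

text \<open>The library's \<open>^\<close> on square matrices is componentwise, so powers are defined separately.\<close>

primrec matpow :: "real^'n^'n \<Rightarrow> nat \<Rightarrow> real^'n^'n" where
  "matpow A 0 = mat 1"
| "matpow A (Suc k) = A ** matpow A k"

definition schur_stable :: "real^'n^'n \<Rightarrow> bool" where
  "schur_stable A \<longleftrightarrow>
     (\<forall>c v. v \<noteq> 0 \<and> map_matrix complex_of_real A *v v = c *s v \<longrightarrow> cmod c < 1)"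

definition stabilizable :: "real^'n^'n \<Rightarrow> real^'m^'n \<Rightarrow> bool" where
  "stabilizable A B \<longleftrightarrow> (\<exists>K. schur_stable (A + B ** K))"

definition riccati :: "real^'n^'n \<Rightarrow> real^'m^'n \<Rightarrow> real^'n^'n \<Rightarrow> real^'m^'m \<Rightarrow> real^'n^'n \<Rightarrow> bool" where
  "riccati A B Q R P \<longleftrightarrow>
     P = Q + transpose A ** P ** A
         - (transpose A ** P ** B) ** matrix_inv (R + transpose B ** P ** B) ** (transpose B ** P ** A)"

definition kron :: "real^'j^'i \<Rightarrow> real^'b^'a \<Rightarrow> real^('j \<times> 'b)^('i \<times> 'a)" where
  "kron X Y = (\<chi> p q. X $ fst p $ fst q * Y $ snd p $ snd q)"

definition block_mat ::
  "real^'a^'a \<Rightarrow> real^'b^'a \<Rightarrow> real^'a^'b \<Rightarrow> real^'b^'b \<Rightarrow> real^('a + 'b)^('a + 'b)" where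
  "block_mat X Y Z W = (\<chi> p q. case p of
       Inl i \<Rightarrow> (case q of Inl j \<Rightarrow> X $ i $ j | Inr j \<Rightarrow> Y $ i $ j)
     | Inr i \<Rightarrow> (case q of Inl j \<Rightarrow> Z $ i $ j | Inr j \<Rightarrow> W $ i $ j))"

definition stack :: "real^'a \<Rightarrow> real^'b \<Rightarrow> real^('a + 'b)" where
  "stack z x = (\<chi> p. case p of Inl i \<Rightarrow> z $ i | Inr j \<Rightarrow> x $ j)"


subsection \<open>The condensed optimal control problem\<close>

definition stage :: "'h::{finite,linorder} \<Rightarrow> nat" where
  "stage j = card {i. i < j}"

definition time :: "'h::{finite,linorder} option \<Rightarrow> nat" where
  "time i = (case i of Some j \<Rightarrow> stage j | None \<Rightarrow> CARD('h))"

definition A_hat :: "real^'n^'n \<Rightarrow> real^'n^('h::{finite,linorder} option \<times> 'n)" where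
  "A_hat A = (\<chi> p b. matpow A (time (fst p)) $ snd p $ b)"

definition B_hat ::
  "real^'n^'n \<Rightarrow> real^'m^'n \<Rightarrow> real^('h::{finite,linorder} \<times> 'm)^('h option \<times> 'n)" where
  "B_hat A B = (\<chi> p q.
     if stage (fst q) < time (fst p)
     then (matpow A (time (fst p) - 1 - stage (fst q)) ** B) $ snd p $ snd q
     else 0)"

definition H_hat ::
  "real^'n^'n \<Rightarrow> real^'n^'n \<Rightarrow> real^('h::{finite,linorder} option \<times> 'n)^('h option \<times> 'n)" where
  "H_hat Q P = (\<chi> p q.
     if fst p = fst q
     then (case fst p of Some _ \<Rightarrow> Q | None \<Rightarrow> P) $ snd p $ snd q
     else 0)"

definition H_mat ::
  "real^'n^'n \<Rightarrow> real^'m^'n \<Rightarrow> real^'n^'n \<Rightarrow> real^'m^'m \<Rightarrow> real^'n^'n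
    \<Rightarrow> real^('h::{finite,linorder} \<times> 'm)^('h \<times> 'm)" where
  "H_mat A B Q R P = transpose (B_hat A B) ** H_hat Q P ** B_hat A B + kron (mat 1) R"

definition G_mat ::
  "real^'n^'n \<Rightarrow> real^'m^'n \<Rightarrow> real^'n^'n \<Rightarrow> real^'n^'n
    \<Rightarrow> real^'n^('h::{finite,linorder} \<times> 'm)" where
  "G_mat A B Q P = transpose (B_hat A B) ** H_hat Q P ** A_hat A"

text \<open>The horizon is not determined by the type of W, hence the extra type argument.\<close>

definition W_mat ::
  "'h::{finite,linorder} itself \<Rightarrow> real^'n^'n \<Rightarrow> real^'n^'n \<Rightarrow> real^'n^'n \<Rightarrow> real^'n^'n" where
  "W_mat _ A Q P =
     transpose (A_hat A) ** (H_hat Q P :: real^('h option \<times> 'n)^('h option \<times> 'n)) ** A_hat A"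

definition M_mat ::
  "real^'n^'n \<Rightarrow> real^'m^'n \<Rightarrow> real^'n^'n \<Rightarrow> real^'m^'m \<Rightarrow> real^'n^'n
    \<Rightarrow> real^(('h::{finite,linorder} \<times> 'm) + 'n)^(('h \<times> 'm) + 'n)" where
  "M_mat A B Q R P =
     block_mat (H_mat A B Q R P) (G_mat A B Q P)
       (transpose (G_mat A B Q P)) (W_mat TYPE('h) A Q P)"

definition feasible :: "(real^'m) set \<Rightarrow> (real^('h::finite \<times> 'm)) set" where
  "feasible U = {z. \<forall>j. (\<chi> a. z $ (j, a)) \<in> U}"

definition cost ::
  "real^'n^'n \<Rightarrow> real^'m^'n \<Rightarrow> real^'n^'n \<Rightarrow> real^'m^'m \<Rightarrow> real^'n^'n
    \<Rightarrow> real^('h::{finite,linorder} \<times> 'm) \<Rightarrow> real^'n \<Rightarrow> real" where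
  "cost A B Q R P z x = (wnorm (M_mat A B Q R P) (stack z x))\<^sup>2"

definition minimizer :: "('a \<Rightarrow> real) \<Rightarrow> 'a set \<Rightarrow> 'a" where
  "minimizer g Z = (THE z. is_arg_min g (\<lambda>z. z \<in> Z) z)"


subsection \<open>The accelerated projected gradient method\<close>

definition grad :: "('a::real_inner \<Rightarrow> real) \<Rightarrow> 'a \<Rightarrow> 'a" where
  "grad g y = (THE D. GDERIV g y :> D)"

text \<open>If \<open>q = 1\<close>, then \<open>\<zeta>\<^sub>0 = 0\<close> and the formula for \<open>\<theta>\<^sub>1\<close> divides by zero;
  with the convention \<open>a / 0 = 0\<close> it yields \<open>\<theta>\<^sub>1 = 0\<close>. This does not affect the iterates
  \<open>z\<^sub>k\<close> below when g is a quadratic whose Hessian is L times the identity: a projected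
  gradient step from any point is then the exact minimizer.\<close>

primrec theta :: "real \<Rightarrow> nat \<Rightarrow> real" where
  "theta q 0 = 1"
| "theta q (Suc k) =
     (let \<zeta> = (theta q k)\<^sup>2 - inverse q
      in \<zeta> / 2 * (sqrt (1 + 4 * (theta q k)\<^sup>2 / \<zeta>\<^sup>2) - 1))"

definition theta_prev :: "real \<Rightarrow> nat \<Rightarrow> real" where
  "theta_prev q k = (case k of 0 \<Rightarrow> 0 | Suc j \<Rightarrow> theta q j)"

text \<open>The state after k iterations is the pair \<open>(z\<^sub>k, v\<^sub>k)\<close>.\<close>

primrec apgm ::
  "'a::euclidean_space set \<Rightarrow> ('a \<Rightarrow> real) \<Rightarrow> real \<Rightarrow> real \<Rightarrow> 'a \<Rightarrow> nat \<Rightarrow> 'a \<times> 'a" where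
  "apgm Z g \<mu> L z0 0 = (z0, z0)"
| "apgm Z g \<mu> L z0 (Suc k) =
     (let (z, v) = apgm Z g \<mu> L z0 k;
          \<theta> = theta (L / \<mu>) k;
          \<gamma> = (theta_prev (L / \<mu>) k)\<^sup>2 * L;
          y = z + (\<theta> * \<gamma> / (\<gamma> + \<mu> * \<theta>)) *\<^sub>R (v - z);
          z' = closest_point Z (y - inverse L *\<^sub>R grad g y);
          v' = z + inverse \<theta> *\<^sub>R (z' - z)
      in (z', v'))"

definition optimizer_map ::
  "real^'k^'k \<Rightarrow> (real^'k) set \<Rightarrow> (real^'k \<Rightarrow> real^'n \<Rightarrow> real) \<Rightarrow> nat
    \<Rightarrow> real^'k \<Rightarrow> real^'n \<Rightarrow> real^'k" where
  "optimizer_map H Z f l z x =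
     fst (apgm Z (\<lambda>w. f w x) (2 * lam_min H) (2 * lam_max H) z l)"

definition eta_a :: "real \<Rightarrow> nat \<Rightarrow> real" where
  "eta_a q l = sqrt q * (1 - q powr (- 1 / 2)) powr ((real l - 1) / 2)"

definition gamma2_a :: "real \<Rightarrow> nat \<Rightarrow> real" where
  "gamma2_a q l = eta_a q l / (1 - eta_a q l)"

text \<open>At \<open>q = 1\<close> the conventions \<open>ln 0 = 0\<close> and \<open>a / 0 = 0\<close> give the value 1, which is
  also the limit as q decreases to 1.\<close>

definition l_bar :: "real \<Rightarrow> real" where
  "l_bar q = 1 - ln q / ln (1 - 1 / sqrt q)"

end

theory Submission
  imports Defs
begin

text \<open>Expanding the condensed cost at a fixed parameter \<open>x\<close> gives the quadratic
  \<open>w \<bullet> H w + 2 (G x) \<bullet> w + const\<close>, and \<open>H\<close> is positive definite because \<open>Q\<close>, \<open>P\<close> and \<open>R\<close> are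
  (\<open>spd_H_mat\<close>, \<open>cost_eq_quad\<close>). Two properties of such a quadratic over a closed convex set
  carry the result.

  The first is a contraction (\<open>apgm_quad_contraction\<close>). From its second iteration on, the
  accelerated method shrinks the Lyapunov function
  \<open>g z\<^sub>k - g z\<^sup>* + L \<theta>\<^sub>k\<^sub>-\<^sub>1\<^sup>2 / 2 \<parallel>v\<^sub>k - z\<^sup>*\<parallel>\<^sup>2\<close> by the factor \<open>1 - \<theta>\<^sub>k \<le> 1 - 1 / \<surd>\<kappa>\<close> per iteration. The
  first iteration is a plain projected gradient step and only bounds that function by
  \<open>L / 2 \<parallel>z\<^sub>0 - z\<^sup>*\<parallel>\<^sup>2\<close>, which is why the exponent is \<open>l - 1\<close>. Since a quadratic grows away from its
  constrained minimizer at least like the squared \<open>H\<close>-norm of the distance (\<open>quad_growth\<close>), and the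
  Euclidean norm costs a factor \<open>\<kappa>\<close> against the \<open>H\<close>-norm, one call of the method contracts
  the \<open>H\<close>-norm distance to \<open>S x\<close> by \<open>eta_a \<kappa> l\<close>. For \<open>\<kappa> > 1\<close> the bound on \<open>l\<close> says
  exactly that this factor is below 1; for \<open>\<kappa> = 1\<close> the factor is 0.

  The second is the Lipschitz dependence of the minimizer on the linear term, with constant 1 from
  the \<open>H\<^sup>-\<^sup>1\<close>-norm to the \<open>H\<close>-norm (\<open>minimizer_quad_lipschitz\<close>); it follows from adding the two
  variational inequalities.

  Hence \<open>a\<^sub>k = \<parallel>e\<^sub>k\<parallel>\<close> and \<open>d\<^sub>k = \<parallel>G \<Delta>x\<^sub>k\<parallel>\<close> in these two norms satisfy
  \<open>a\<^sub>k\<^sub>+\<^sub>1 \<le> \<eta> (a\<^sub>k + d\<^sub>k)\<close>, and both claims are statements about this scalar recursion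
  (\<open>decay_recursion_ISS\<close>, \<open>decay_recursion_limsup\<close>).\<close>

section \<open>Quadratic forms of symmetric matrices\<close>

lemma symmetric_inner_matrix:
  fixes M :: "real^'n^'n"
  assumes "transpose M = M"
  shows "(M *v x) \<bullet> y = x \<bullet> (M *v y)"
  by (metis assms dot_lmul_matrix transpose_matrix_vector)

lemma inner_transpose_matrix:
  fixes M :: "real^'n^'m"
  shows "x \<bullet> (transpose M *v y) = (M *v x) \<bullet> y"
  by (metis dot_lmul_matrix inner_commute transpose_matrix_vector)

text \<open>Otherwise a small step from \<open>u\<close> against \<open>K u\<close> would make the form negative: its first-order
  change is \<open>-2 t \<parallel>K u\<parallel>\<^sup>2\<close> and the rest is quadratic in \<open>t\<close>.\<close>

lemma psd_zero_imp_kernel: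
  fixes K :: "real^'n^'n"
  assumes sym: "transpose K = K" and psd: "\<And>x. 0 \<le> x \<bullet> (K *v x)" and u: "u \<bullet> (K *v u) = 0"
  shows "K *v u = 0"
proof (rule ccontr)
  define w where "w = K *v u"
  define b where "b = w \<bullet> (K *v w)"
  assume "K *v u \<noteq> 0"
  then have ww: "0 < w \<bullet> w" by (simp add: w_def)
  have exp: "(u - t *\<^sub>R w) \<bullet> (K *v (u - t *\<^sub>R w)) = t\<^sup>2 * b - 2 * t * (w \<bullet> w)" for t
    using u symmetric_inner_matrix[OF sym, of u w]
    by (simp add: b_def w_def matrix_vector_mult_diff_distrib matrix_vector_mult_scaleR
        inner_diff_left inner_diff_right power2_eq_square inner_commute algebra_simps)
  have b0: "0 \<le> b" using psd by (simp add: b_def)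
  \<comment> \<open>Any \<open>t > 0\<close> with \<open>t b < 2 (w \<bullet> w)\<close> would do; adding 1 avoids a case distinction on \<open>b = 0\<close>.\<close>
  define t where "t = (w \<bullet> w) / (b + 1)"
  have t0: "0 < t" using ww b0 by (simp add: t_def)
  have "t * b \<le> t * (b + 1)" using t0 by simp
  also have "\<dots> = w \<bullet> w" using b0 by (simp add: t_def)
  finally have "t * b - 2 * (w \<bullet> w) < 0" using ww by linarith
  then have "t * (t * b - 2 * (w \<bullet> w)) < 0" using t0 by (rule mult_pos_neg[rotated])
  moreover have "0 \<le> t * (t * b - 2 * (w \<bullet> w))"
    using psd[of "u - t *\<^sub>R w"] exp[of t] by (simp add: power2_eq_square algebra_simps)
  ultimately show False by linarith
qed

text \<open>The form attains its maximum \<open>c\<close> on the unit sphere at some \<open>u\<close>. Then \<open>c I - M\<close> is positive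
  semidefinite and its form vanishes at \<open>u\<close>, so that \<open>u\<close> lies in its kernel.\<close>

lemma rayleigh_max_eigenvalue:
  fixes M :: "real^'n^'n"
  assumes sym: "transpose M = M"
  obtains c where "eigenvalue M c" "\<And>x. x \<bullet> (M *v x) \<le> c * (norm x)\<^sup>2"
proof -
  have "\<exists>u\<in>sphere (0::real^'n) 1. \<forall>y\<in>sphere 0 1. y \<bullet> (M *v y) \<le> u \<bullet> (M *v u)"
  proof (rule continuous_attains_sup)
    show "sphere (0::real^'n) 1 \<noteq> {}"
      using vector_choose_size[of 1] by force
    show "continuous_on (sphere 0 1) (\<lambda>y. y \<bullet> (M *v y))"
      by (intro continuous_intros linear_continuous_on matrix_vector_mul_bounded_linear)
  qed auto
  then obtain u where u: "norm u = 1"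
    and max: "\<And>y. norm y = 1 \<Longrightarrow> y \<bullet> (M *v y) \<le> u \<bullet> (M *v u)" by auto
  define c where "c = u \<bullet> (M *v u)"
  have le: "x \<bullet> (M *v x) \<le> c * (norm x)\<^sup>2" for x
  proof (cases "x = 0")
    case False
    have "(x /\<^sub>R norm x) \<bullet> (M *v (x /\<^sub>R norm x)) \<le> c"
      unfolding c_def using False by (intro max) simp
    then show ?thesis
      using False by (simp add: matrix_vector_mult_scaleR field_simps power2_eq_square)
  qed simp
  define K where "K = c *\<^sub>R mat 1 - M"
  have Kv: "K *v x = c *\<^sub>R x - M *v x" for x
    by (simp add: K_def matrix_vector_mult_diff_rdistrib scaleR_matrix_vector_assoc[symmetric])
  have "transpose K = K"
    using sym by (simp add: K_def vec_eq_iff transpose_def mat_def)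
  then have "K *v u = 0"
  proof (rule psd_zero_imp_kernel)
    show "0 \<le> x \<bullet> (K *v x)" for x
      using le[of x] by (simp add: Kv inner_diff_right power2_norm_eq_inner)
    show "u \<bullet> (K *v u) = 0"
      using u by (simp add: Kv inner_diff_right c_def norm_eq_1)
  qed
  then have "eigenvalue M c"
    unfolding eigenvalue_def using u by (intro exI[of _ u]) (auto simp: Kv)
  then show thesis using le by (rule that)
qed

lemma rayleigh_min_eigenvalue:
  fixes M :: "real^'n^'n"
  assumes sym: "transpose M = M"
  obtains c where "eigenvalue M c" "\<And>x. c * (norm x)\<^sup>2 \<le> x \<bullet> (M *v x)"
proof -
  have neg: "(- M) *v x = - (M *v x)" for x
    by (simp add: vec_eq_iff matrix_vector_mult_def sum_negf)
  have "transpose (- M) = - M" using sym by (simp add: vec_eq_iff transpose_def)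
  from rayleigh_max_eigenvalue[OF this] obtain c
    where c: "eigenvalue (- M) c" "\<And>x. x \<bullet> ((- M) *v x) \<le> c * (norm x)\<^sup>2" by blast
  have "eigenvalue M (- c)"
    using c(1) unfolding eigenvalue_def neg by (metis minus_minus scaleR_minus_left)
  moreover have "- c * (norm x)\<^sup>2 \<le> x \<bullet> (M *v x)" for x
    using c(2)[of x] by (simp add: neg)
  ultimately show thesis by (rule that)
qed

text \<open>Eigenvectors of distinct eigenvalues are orthogonal. Finiteness matters because \<open>lam_min\<close> and
  \<open>lam_max\<close> are \<open>Min\<close> and \<open>Max\<close> of the set of eigenvalues.\<close>

lemma finite_eigenvalues:
  fixes M :: "real^'n^'n"
  assumes sym: "transpose M = M"
  shows "finite {c. eigenvalue M c}"
proof -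
  define E where "E = {c. eigenvalue M c}"
  define v where "v c = (SOME w. w \<noteq> 0 \<and> M *v w = c *\<^sub>R w)" for c
  have v: "v c \<noteq> 0 \<and> M *v v c = c *\<^sub>R v c" if "c \<in> E" for c
    using that someI_ex[of "\<lambda>w. w \<noteq> 0 \<and> M *v w = c *\<^sub>R w"]
    by (simp add: v_def E_def eigenvalue_def)
  have orth: "v c \<bullet> v d = 0" if "c \<in> E" "d \<in> E" "c \<noteq> d" for c d
  proof -
    have "c * (v c \<bullet> v d) = d * (v c \<bullet> v d)"
      using symmetric_inner_matrix[OF sym, of "v c" "v d"] v[OF that(1)] v[OF that(2)] by simp
    then show ?thesis using that by simp
  qed
  have inj: "inj_on v E"
  proof (rule inj_onI)
    fix c d assume cd: "c \<in> E" "d \<in> E" "v c = v d"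
    then show "c = d" using orth[of c d] v[of d] by auto
  qed
  have "pairwise orthogonal (v ` E)"
    unfolding pairwise_def orthogonal_def using orth by blast
  then have "finite (v ` E)" by (rule pairwise_orthogonal_imp_finite)
  then show ?thesis using finite_imageD[OF _ inj] by (simp add: E_def)
qed

lemma rayleigh_bounds:
  fixes M :: "real^'n^'n"
  assumes sym: "transpose M = M"
  shows "lam_min M * (norm x)\<^sup>2 \<le> x \<bullet> (M *v x)"
    and "x \<bullet> (M *v x) \<le> lam_max M * (norm x)\<^sup>2"
proof -
  obtain c where c: "eigenvalue M c" "\<And>x. c * (norm x)\<^sup>2 \<le> x \<bullet> (M *v x)"
    using rayleigh_min_eigenvalue[OF sym] by blast
  have "lam_min M \<le> c"
    unfolding lam_min_def using c(1) finite_eigenvalues[OF sym] by (intro Min_le) auto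
  then have "lam_min M * (norm x)\<^sup>2 \<le> c * (norm x)\<^sup>2" by (simp add: mult_right_mono)
  then show "lam_min M * (norm x)\<^sup>2 \<le> x \<bullet> (M *v x)" using c(2)[of x] by linarith
  obtain d where d: "eigenvalue M d" "\<And>x. x \<bullet> (M *v x) \<le> d * (norm x)\<^sup>2"
    using rayleigh_max_eigenvalue[OF sym] by blast
  have "d \<le> lam_max M"
    unfolding lam_max_def using d(1) finite_eigenvalues[OF sym] by (intro Max_ge) auto
  then have "d * (norm x)\<^sup>2 \<le> lam_max M * (norm x)\<^sup>2" by (simp add: mult_right_mono)
  then show "x \<bullet> (M *v x) \<le> lam_max M * (norm x)\<^sup>2" using d(2)[of x] by linarith
qed

lemma spd_symmetric: "spd M \<Longrightarrow> transpose M = M"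
  by (simp add: spd_def)

lemma spd_nonneg: "spd M \<Longrightarrow> 0 \<le> x \<bullet> (M *v x)"
  by (cases "x = 0") (auto simp: spd_def intro: less_imp_le)

lemma spd_eigenvalues:
  fixes M :: "real^'n^'n"
  assumes "spd M"
  shows "0 < lam_min M" and "lam_min M \<le> lam_max M"
proof -
  have sym: "transpose M = M" using assms by (rule spd_symmetric)
  obtain c where "eigenvalue M c" using rayleigh_min_eigenvalue[OF sym] by blast
  then have ne: "{c. eigenvalue M c} \<noteq> {}" by blast
  have "lam_min M \<in> {c. eigenvalue M c}"
    unfolding lam_min_def by (rule Min_in[OF finite_eigenvalues[OF sym] ne])
  then obtain v where v: "v \<noteq> 0" "M *v v = lam_min M *\<^sub>R v" by (auto simp: eigenvalue_def)
  have "0 < v \<bullet> (M *v v)" using assms v(1) by (simp add: spd_def)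
  then have "0 < lam_min M * (v \<bullet> v)" by (simp add: v(2))
  then show "0 < lam_min M" using v(1) by (metis inner_ge_zero mult_nonneg_nonneg not_le
        zero_less_mult_pos2 inner_gt_zero_iff)
  show "lam_min M \<le> lam_max M"
    unfolding lam_min_def lam_max_def
    using Min_in[OF finite_eigenvalues[OF sym] ne] finite_eigenvalues[OF sym] by (intro Max_ge)
qed

lemma wnorm_power2: "spd M \<Longrightarrow> (wnorm M x)\<^sup>2 = x \<bullet> (M *v x)"
  by (simp add: wnorm_def spd_nonneg)

lemma wnorm_nonneg: "spd M \<Longrightarrow> 0 \<le> wnorm M x"
  by (simp add: wnorm_def spd_nonneg)

lemma spd_Cauchy_Schwarz:
  fixes M :: "real^'n^'n"
  assumes M: "spd M"
  shows "x \<bullet> (M *v y) \<le> wnorm M x * wnorm M y"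
proof (cases "y = 0")
  case False
  define a b d where "a = x \<bullet> (M *v x)" and "b = x \<bullet> (M *v y)" and "d = y \<bullet> (M *v y)"
  have d: "0 < d" using M False by (simp add: d_def spd_def)
  have comm: "y \<bullet> (M *v x) = b"
    using symmetric_inner_matrix[OF spd_symmetric[OF M], of y x] by (simp add: b_def inner_commute)
  have "0 \<le> (d *\<^sub>R x - b *\<^sub>R y) \<bullet> (M *v (d *\<^sub>R x - b *\<^sub>R y))" by (rule spd_nonneg[OF M])
  also have "\<dots> = d * (a * d - b\<^sup>2)"
    using comm
    by (simp add: a_def[symmetric] b_def[symmetric] d_def[symmetric] matrix_vector_mult_diff_distrib
        matrix_vector_mult_scaleR inner_diff_left inner_diff_right power2_eq_square algebra_simps)
  finally have "b\<^sup>2 \<le> a * d" using d by (simp add: zero_le_mult_iff)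
  also have "a * d = (wnorm M x * wnorm M y)\<^sup>2"
    by (simp add: power_mult_distrib wnorm_power2[OF M] a_def d_def)
  finally show ?thesis
    unfolding b_def by (rule power2_le_imp_le) (simp add: wnorm_nonneg[OF M])
qed (simp add: wnorm_def)

lemma wnorm_triangle:
  fixes M :: "real^'n^'n"
  assumes M: "spd M"
  shows "wnorm M (x + y) \<le> wnorm M x + wnorm M y"
proof (rule power2_le_imp_le)
  have "y \<bullet> (M *v x) = x \<bullet> (M *v y)"
    using symmetric_inner_matrix[OF spd_symmetric[OF M], of y x] by (simp add: inner_commute)
  then have "(wnorm M (x + y))\<^sup>2 = (wnorm M x)\<^sup>2 + 2 * (x \<bullet> (M *v y)) + (wnorm M y)\<^sup>2"
    by (simp add: wnorm_power2[OF M] matrix_vector_right_distrib inner_add_left inner_add_right)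
  also have "\<dots> \<le> (wnorm M x + wnorm M y)\<^sup>2"
    using spd_Cauchy_Schwarz[OF M, of x y] by (simp add: power2_sum)
  finally show "(wnorm M (x + y))\<^sup>2 \<le> (wnorm M x + wnorm M y)\<^sup>2" .
qed (simp add: wnorm_nonneg[OF M])

lemma spd_matrix_inv_cancel:
  fixes M :: "real^'n^'n"
  assumes M: "spd M"
  shows "M *v (matrix_inv M *v g) = g"
proof -
  have "inj ((*v) M)"
  proof (rule linear_injective_0[THEN iffD2, rule_format])
    fix x assume "M *v x = 0"
    then show "x = 0" using M by (metis inner_zero_right less_irrefl spd_def)
  qed simp
  then have "invertible M"
    using invertible_left_inverse matrix_left_invertible_injective by blast
  then have "M ** matrix_inv M = mat 1"
    unfolding invertible_def matrix_inv_def by (rule someI2_ex) blast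
  then show ?thesis by (simp add: matrix_vector_mul_assoc)
qed

lemma wnorm_matrix_inv:
  assumes M: "spd M"
  shows "wnorm (matrix_inv M) g = wnorm M (matrix_inv M *v g)"
  by (simp add: wnorm_def spd_matrix_inv_cancel[OF M] inner_commute)

lemma spd_dual_Cauchy_Schwarz:
  fixes M :: "real^'n^'n"
  assumes M: "spd M"
  shows "g \<bullet> d \<le> wnorm (matrix_inv M) g * wnorm M d"
  using spd_Cauchy_Schwarz[OF M, of d "matrix_inv M *v g"]
  by (simp add: spd_matrix_inv_cancel[OF M] wnorm_matrix_inv[OF M] inner_commute mult.commute)

section \<open>The accelerated projected gradient method\<close>

text \<open>The three-point inequality behind every projected gradient method. The displacement \<open>y - z'\<close>
  plays the part of the gradient divided by \<open>L\<close>, because the obtuse angle at the projection gives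
  \<open>L (y - z') \<bullet> (w - z') \<le> d \<bullet> (w - z')\<close>. The point \<open>y\<close> may lie outside \<open>Z\<close>, as the extrapolated
  points of the accelerated method do.\<close>

lemma projected_gradient_inequality:
  fixes Z :: "'a::euclidean_space set"
  assumes Z: "closed Z" "convex Z" and w: "w \<in> Z" and L: "0 < L"
    and lower: "g w \<ge> g y + d \<bullet> (w - y) + \<mu> / 2 * (norm (w - y))\<^sup>2"
    and upper: "\<And>u. g u \<le> g y + d \<bullet> (u - y) + L / 2 * (norm (u - y))\<^sup>2"
    and z': "z' = closest_point Z (y - inverse L *\<^sub>R d)"
  shows "g z' + L * ((y - z') \<bullet> (w - y)) + L / 2 * (norm (y - z'))\<^sup>2 + \<mu> / 2 * (norm (w - y))\<^sup>2 \<le> g w"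
proof -
  define r where "r = y - z'"
  have "(y - inverse L *\<^sub>R d - z') \<bullet> (w - z') \<le> 0"
    unfolding z' by (rule closest_point_dot[OF Z(2,1) w])
  then have "inverse L * (d \<bullet> (w - z')) \<ge> r \<bullet> (w - z')"
    by (simp add: r_def inner_diff_left algebra_simps)
  then have proj: "L * (r \<bullet> (w - z')) \<le> d \<bullet> (w - z')"
    using L by (simp add: field_simps)
  have "r \<bullet> (w - z') = r \<bullet> (w - y) + (norm r)\<^sup>2"
    by (simp add: r_def power2_norm_eq_inner inner_diff_left inner_diff_right inner_commute)
  moreover have "d \<bullet> (w - z') = d \<bullet> (w - y) - d \<bullet> (z' - y)"
    by (simp add: inner_diff_right)
  moreover have "(norm (z' - y))\<^sup>2 = (norm r)\<^sup>2" by (simp add: r_def norm_minus_commute)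
  ultimately show ?thesis
    using proj lower upper[of z'] unfolding r_def[symmetric] by (simp add: algebra_simps)
qed

lemma half_norm_diff_expand:
  fixes y z' zs :: "'a::real_inner" and L :: real
  shows "L / 2 * (norm (z' - zs))\<^sup>2
    = L / 2 * (norm (y - z'))\<^sup>2 + L * ((y - z') \<bullet> (zs - y)) + L / 2 * (norm (zs - y))\<^sup>2"
proof -
  define r a where "r = y - z'" and "a = zs - y"
  have "z' - zs = - (r + a)" by (simp add: r_def a_def)
  then have "(norm (z' - zs))\<^sup>2 = (norm (r + a))\<^sup>2" by (metis norm_minus_cancel)
  also have "\<dots> = (norm r)\<^sup>2 + 2 * (r \<bullet> a) + (norm a)\<^sup>2"
    by (simp add: power2_norm_eq_inner inner_add_left inner_add_right inner_commute)
  finally show ?thesis by (simp add: r_def[symmetric] a_def[symmetric] algebra_simps)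
qed

lemma norm_weighted_sum_le:
  fixes a b :: "'a::real_inner"
  assumes "0 \<le> \<alpha>" "0 \<le> \<beta>"
  shows "(norm (\<alpha> *\<^sub>R a + \<beta> *\<^sub>R b))\<^sup>2 \<le> (\<alpha> + \<beta>) * (\<alpha> * (norm a)\<^sup>2 + \<beta> * (norm b)\<^sup>2)"
proof -
  have "(\<alpha> + \<beta>) * (\<alpha> * (norm a)\<^sup>2 + \<beta> * (norm b)\<^sup>2) - (norm (\<alpha> *\<^sub>R a + \<beta> *\<^sub>R b))\<^sup>2
      = \<alpha> * \<beta> * (norm (a - b))\<^sup>2"
    by (simp add: power2_norm_eq_inner inner_add_left inner_add_right inner_diff_left
        inner_diff_right inner_commute[of b a] algebra_simps)
  moreover have "0 \<le> \<alpha> * \<beta> * (norm (a - b))\<^sup>2" using assms by simp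
  ultimately show ?thesis by linarith
qed

text \<open>One step of the estimate-sequence argument. The inequalities \<open>opt\<close> and \<open>desc\<close> compare the new
  point with the minimizer \<open>zs\<close> and the old iterate \<open>z\<close>; they are added with the weights \<open>\<theta>\<close> and
  \<open>1 - \<theta>\<close>. The formulas for \<open>y\<close> and \<open>v'\<close> are the ones that cancel all terms linear in \<open>y - z'\<close>;
  what remains is convexity of the squared norm with weights \<open>\<theta> \<mu>\<close> and \<open>(1 - \<theta>) \<gamma>\<close>, whose sum is
  \<open>L \<theta>\<^sup>2\<close> by the recursion for \<open>\<theta>\<close>. Points are taken relative to \<open>y\<close> throughout.\<close>

lemma apgm_lyapunov_step:
  fixes y z v z' zs :: "'a::real_inner"
  assumes \<theta>: "0 < \<theta>" "\<theta> \<le> 1" and pos: "0 \<le> \<gamma>" "0 < \<mu>" "0 < L"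
    and \<gamma>': "L * \<theta>\<^sup>2 = (1 - \<theta>) * \<gamma> + \<theta> * \<mu>"
    and y: "y = z + (\<theta> * \<gamma> / (\<gamma> + \<mu> * \<theta>)) *\<^sub>R (v - z)"
    and v': "v' = z + inverse \<theta> *\<^sub>R (z' - z)"
    and opt: "gz' + L * ((y - z') \<bullet> (zs - y)) + L / 2 * (norm (y - z'))\<^sup>2
        + \<mu> / 2 * (norm (zs - y))\<^sup>2 \<le> gs"
    and desc: "gz' + L * ((y - z') \<bullet> (z - y)) + L / 2 * (norm (y - z'))\<^sup>2
        + \<mu> / 2 * (norm (z - y))\<^sup>2 \<le> gz"
  shows "gz' - gs + L * \<theta>\<^sup>2 / 2 * (norm (v' - zs))\<^sup>2
      \<le> (1 - \<theta>) * (gz - gs + \<gamma> / 2 * (norm (v - zs))\<^sup>2)"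
proof -
  define r a b u where "r = y - z'" and "a = zs - y" and "b = z - y" and "u = v - y"
  define s where "s = (1 - \<theta>) *\<^sub>R b + \<theta> *\<^sub>R a"
  have den: "0 < \<gamma> + \<mu> * \<theta>" using \<theta> pos by (simp add: add_nonneg_pos)
  have sum: "L * \<theta>\<^sup>2 + \<theta> * \<gamma> = \<gamma> + \<mu> * \<theta>" using \<gamma>' by (simp add: algebra_simps)
  \<comment> \<open>The extrapolation weight makes \<open>y\<close> the average of \<open>z\<close> and \<open>v\<close> with weights \<open>L \<theta>\<^sup>2\<close> and \<open>\<theta> \<gamma>\<close>.\<close>
  have bal: "(L * \<theta>\<^sup>2) *\<^sub>R b + (\<theta> * \<gamma>) *\<^sub>R u = 0"
  proof -
    have "(\<gamma> + \<mu> * \<theta>) *\<^sub>R (y - z) = (\<theta> * \<gamma>) *\<^sub>R (v - z)" using den by (simp add: y)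
    moreover have "(L * \<theta>\<^sup>2) *\<^sub>R b + (\<theta> * \<gamma>) *\<^sub>R u
        = (\<theta> * \<gamma>) *\<^sub>R (v - z) - (L * \<theta>\<^sup>2 + \<theta> * \<gamma>) *\<^sub>R (y - z)"
      by (simp add: b_def u_def algebra_simps)
    ultimately show ?thesis unfolding sum by simp
  qed
  have bal': "(L * \<theta>) *\<^sub>R b = - (\<gamma> *\<^sub>R u)"
  proof -
    have "\<theta> *\<^sub>R ((L * \<theta>) *\<^sub>R b + \<gamma> *\<^sub>R u) = 0"
      using bal by (simp add: algebra_simps power2_eq_square)
    then show ?thesis using \<theta> by (simp add: eq_neg_iff_add_eq_0)
  qed
  have s: "(L * \<theta>) *\<^sub>R s = (\<theta> * \<mu>) *\<^sub>R a + ((1 - \<theta>) * \<gamma>) *\<^sub>R (a - u)"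
  proof -
    have "(L * \<theta>) *\<^sub>R s = (1 - \<theta>) *\<^sub>R ((L * \<theta>) *\<^sub>R b) + (L * \<theta>\<^sup>2) *\<^sub>R a"
      by (simp add: s_def algebra_simps power2_eq_square)
    then show ?thesis unfolding bal' \<gamma>' by (simp add: algebra_simps)
  qed
  have key: "L * (norm s)\<^sup>2 \<le> \<theta> * \<mu> * (norm a)\<^sup>2 + (1 - \<theta>) * \<gamma> * (norm (a - u))\<^sup>2" (is "_ \<le> ?X")
  proof -
    have "(L * \<theta>\<^sup>2) * (L * (norm s)\<^sup>2) = (norm ((L * \<theta>) *\<^sub>R s))\<^sup>2"
      by (simp add: power_mult_distrib power2_eq_square)
    also have "\<dots> \<le> (\<theta> * \<mu> + (1 - \<theta>) * \<gamma>) * ?X"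
      unfolding s using \<theta> pos by (intro norm_weighted_sum_le) auto
    also have "\<dots> = (L * \<theta>\<^sup>2) * ?X" unfolding \<gamma>' by (simp add: algebra_simps)
    finally show ?thesis using \<theta> pos by simp
  qed
  \<comment> \<open>Hence the cross term \<open>L (r \<bullet> s)\<close> in \<open>v'_norm\<close> below is the one that \<open>opt\<close> and \<open>desc\<close> supply.\<close>
  have "\<theta> *\<^sub>R (v' - zs) = - (s + r)"
    using \<theta> by (simp add: v' s_def r_def a_def b_def algebra_simps)
  then have "(norm (\<theta> *\<^sub>R (v' - zs)))\<^sup>2 = (norm (s + r))\<^sup>2" by (metis norm_minus_cancel)
  then have "\<theta>\<^sup>2 * (norm (v' - zs))\<^sup>2 = (norm s)\<^sup>2 + 2 * (r \<bullet> s) + (norm r)\<^sup>2"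
    by (simp add: power_mult_distrib power2_norm_eq_inner inner_add_left inner_add_right inner_commute)
  then have "L / 2 * (\<theta>\<^sup>2 * (norm (v' - zs))\<^sup>2) = L / 2 * ((norm s)\<^sup>2 + 2 * (r \<bullet> s) + (norm r)\<^sup>2)"
    by simp
  then have v'_norm: "L * \<theta>\<^sup>2 / 2 * (norm (v' - zs))\<^sup>2
      = L / 2 * (norm s)\<^sup>2 + L * (r \<bullet> s) + L / 2 * (norm r)\<^sup>2"
    by (simp add: algebra_simps)
  have "gz' + L * (r \<bullet> b) + L / 2 * (norm r)\<^sup>2 \<le> gz"
  proof -
    have "0 \<le> \<mu> / 2 * (norm b)\<^sup>2" using pos by simp
    then show ?thesis using desc unfolding r_def[symmetric] b_def[symmetric] by linarith
  qed
  then have A: "(1 - \<theta>) * (gz' + L * (r \<bullet> b) + L / 2 * (norm r)\<^sup>2) \<le> (1 - \<theta>) * gz"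
    using \<theta> by (intro mult_left_mono) auto
  have B: "\<theta> * (gz' + L * (r \<bullet> a) + L / 2 * (norm r)\<^sup>2 + \<mu> / 2 * (norm a)\<^sup>2) \<le> \<theta> * gs"
    using opt \<theta> unfolding r_def[symmetric] a_def[symmetric] by (intro mult_left_mono) auto
  have rs: "r \<bullet> s = (1 - \<theta>) * (r \<bullet> b) + \<theta> * (r \<bullet> a)" by (simp add: s_def inner_add_right)
  have au: "norm (v - zs) = norm (a - u)" by (simp add: a_def u_def norm_minus_commute)
  have C: "gz' + L * (r \<bullet> s) + L / 2 * (norm r)\<^sup>2 + \<theta> * (\<mu> / 2) * (norm a)\<^sup>2
      \<le> (1 - \<theta>) * gz + \<theta> * gs"
    using add_mono[OF A B] unfolding rs
    by (simp add: algebra_simps add_divide_distrib diff_divide_distrib)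
  show ?thesis
    using C key unfolding v'_norm au
    by (simp add: algebra_simps add_divide_distrib diff_divide_distrib)
qed

text \<open>The next value is the positive root of \<open>p(s) = s\<^sup>2 + \<zeta> s - \<theta>\<^sub>k\<^sup>2\<close>. As \<open>p(1 / \<surd>q) < 0 \<le> p(1)\<close>, the
  root stays above \<open>1 / \<surd>q\<close> and does not exceed 1, and \<open>\<zeta>\<close> stays positive.\<close>

lemma theta_properties:
  assumes q: "1 < q"
  shows "1 / sqrt q < theta q k" and "theta q k \<le> 1"
    and "(theta q (Suc k))\<^sup>2 = (1 - theta q (Suc k)) * (theta q k)\<^sup>2 + theta q (Suc k) / q"
proof -
  define t0 where "t0 = 1 / sqrt q"
  have t0: "0 < t0" "t0 < 1" "t0\<^sup>2 = 1 / q" using q by (auto simp: t0_def power_divide)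
  have step: "t0 < theta q (Suc k) \<and> theta q (Suc k) \<le> 1 \<and>
      (theta q (Suc k))\<^sup>2 = (1 - theta q (Suc k)) * (theta q k)\<^sup>2 + theta q (Suc k) / q"
    if t: "t0 < theta q k" "theta q k \<le> 1" for k
  proof -
    define t where "t = theta q k"
    define \<zeta> where "\<zeta> = t\<^sup>2 - 1 / q"
    define s where "s = sqrt (\<zeta>\<^sup>2 + 4 * t\<^sup>2)"
    have t': "t0 < t" "t \<le> 1" using t by (simp_all add: t_def)
    have "t0\<^sup>2 < t\<^sup>2" using t' t0 by (intro power_strict_mono) auto
    then have \<zeta>: "0 < \<zeta>" by (simp add: \<zeta>_def t0)
    have s2: "s\<^sup>2 = \<zeta>\<^sup>2 + 4 * t\<^sup>2" by (simp add: s_def)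
    have s0: "0 \<le> s" by (simp add: s_def)
    have "1 + 4 * t\<^sup>2 / \<zeta>\<^sup>2 = (\<zeta>\<^sup>2 + 4 * t\<^sup>2) / \<zeta>\<^sup>2" using \<zeta> by (simp add: field_simps)
    then have "sqrt (1 + 4 * t\<^sup>2 / \<zeta>\<^sup>2) = s / \<zeta>"
      using \<zeta> by (simp add: s_def real_sqrt_divide)
    then have th: "theta q (Suc k) = (s - \<zeta>) / 2"
      using \<zeta> by (simp add: Let_def t_def[symmetric] \<zeta>_def[symmetric] inverse_eq_divide field_simps)
    have quad: "((s - \<zeta>) / 2)\<^sup>2 + \<zeta> * ((s - \<zeta>) / 2) = t\<^sup>2"
      using s2 by (simp add: power2_eq_square field_simps)
    have "(\<zeta> + 2 * t0)\<^sup>2 < s\<^sup>2"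
    proof -
      have "0 < (t\<^sup>2 - t0\<^sup>2) * (1 - t0)" using \<zeta> t0 by (simp add: \<zeta>_def)
      then have "t0\<^sup>2 + \<zeta> * t0 < t\<^sup>2" by (simp add: \<zeta>_def t0(3)[symmetric] algebra_simps)
      then show ?thesis by (simp add: s2 power2_sum power_mult_distrib algebra_simps)
    qed
    then have "\<zeta> + 2 * t0 < s" using s0 by (rule power2_less_imp_less)
    moreover have "s\<^sup>2 \<le> (\<zeta> + 2)\<^sup>2"
    proof -
      have "t\<^sup>2 \<le> \<zeta> + 1" using q by (simp add: \<zeta>_def)
      then show ?thesis by (simp add: s2 power2_sum)
    qed
    then have "s \<le> \<zeta> + 2" by (rule power2_le_imp_le) (use \<zeta> in simp)
    moreover have "(theta q (Suc k))\<^sup>2 = (1 - theta q (Suc k)) * t\<^sup>2 + theta q (Suc k) / q"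
    proof -
      have "(theta q (Suc k))\<^sup>2 + (t\<^sup>2 - 1 / q) * theta q (Suc k) = t\<^sup>2"
        using quad unfolding th \<zeta>_def by simp
      then show ?thesis by (simp add: algebra_simps del: theta.simps)
    qed
    ultimately show ?thesis unfolding th t_def by simp
  qed
  have "t0 < theta q k \<and> theta q k \<le> 1"
    by (induction k) (use t0 step in \<open>auto simp del: theta.simps(2)\<close>)
  then show "1 / sqrt q < theta q k" "theta q k \<le> 1"
    "(theta q (Suc k))\<^sup>2 = (1 - theta q (Suc k)) * (theta q k)\<^sup>2 + theta q (Suc k) / q"
    using step[of k] by (auto simp: t0_def simp del: theta.simps)
qed

text \<open>Gradients are unique, so the definite description in \<open>grad\<close> denotes.\<close>

lemma grad_eqI: "GDERIV g y :> d \<Longrightarrow> grad g y = d"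
proof -
  assume d: "GDERIV g y :> d"
  have "d' = d" if "GDERIV g y :> d'" for d'
  proof -
    have "(\<lambda>h. h \<bullet> d') = (\<lambda>h. h \<bullet> d)"
      using has_derivative_unique that d unfolding gderiv_def by blast
    then show ?thesis by (metis inner_commute vector_eq_rdot)
  qed
  with d show ?thesis unfolding grad_def by blast
qed

lemma apgm_in_set:
  assumes "closed Z" "z0 \<in> Z"
  shows "fst (apgm Z g \<mu> L z0 k) \<in> Z"
proof (cases k)
  case (Suc j)
  have "Z \<noteq> {}" using assms by blast
  then show ?thesis
    using Suc assms by (simp add: Let_def split: prod.split) (metis closest_point_in_set)
qed (use assms in simp)

text \<open>If \<open>\<mu> = L\<close>, the values of \<open>theta\<close> degenerate, but then \<open>g\<close> is squeezed between two equal
  quadratics and a single projected gradient step from any point reaches the minimizer. Otherwise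
  the Lyapunov function decreases geometrically after the first iteration.\<close>

theorem apgm_convergence:
  fixes Z :: "'a::euclidean_space set"
  assumes Z: "closed Z" "convex Z" and z0: "z0 \<in> Z" and zs: "zs \<in> Z"
    and \<mu>L: "0 < \<mu>" "\<mu> \<le> L"
    and deriv: "\<And>y. GDERIV g y :> d y"
    and lower: "\<And>w y. g w \<ge> g y + d y \<bullet> (w - y) + \<mu> / 2 * (norm (w - y))\<^sup>2"
    and upper: "\<And>w y. g w \<le> g y + d y \<bullet> (w - y) + L / 2 * (norm (w - y))\<^sup>2"
    and min: "\<And>w. w \<in> Z \<Longrightarrow> g zs \<le> g w"
  shows "g (fst (apgm Z g \<mu> L z0 (Suc k))) - g zs
    \<le> (1 - 1 / sqrt (L / \<mu>)) ^ k * (L / 2 * (norm (z0 - zs))\<^sup>2)"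
proof -
  define q where "q = L / \<mu>"
  define zz where "zz k = fst (apgm Z g \<mu> L z0 k)" for k
  define vv where "vv k = snd (apgm Z g \<mu> L z0 k)" for k
  define yy where "yy k = zz k + (theta q k * ((theta_prev q k)\<^sup>2 * L)
      / ((theta_prev q k)\<^sup>2 * L + \<mu> * theta q k)) *\<^sub>R (vv k - zz k)" for k
  have L: "0 < L" using \<mu>L by simp
  have zz0: "zz 0 = z0" "vv 0 = z0" by (simp_all add: zz_def vv_def)
  have zzS: "zz (Suc k) = closest_point Z (yy k - inverse L *\<^sub>R d (yy k))" for k
    by (simp add: zz_def vv_def yy_def q_def Let_def case_prod_beta grad_eqI[OF deriv])
  have vvS: "vv (Suc k) = zz k + inverse (theta q k) *\<^sub>R (zz (Suc k) - zz k)" for k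
    by (simp add: zz_def vv_def q_def Let_def case_prod_beta)
  have zzZ: "zz k \<in> Z" for k
    unfolding zz_def by (rule apgm_in_set[OF Z(1) z0])
  have pg: "g (zz (Suc k)) + L * ((yy k - zz (Suc k)) \<bullet> (w - yy k))
      + L / 2 * (norm (yy k - zz (Suc k)))\<^sup>2 + \<mu> / 2 * (norm (w - yy k))\<^sup>2 \<le> g w"
    if "w \<in> Z" for w k
    by (rule projected_gradient_inequality[OF Z that L lower upper zzS])
  show ?thesis
  proof (cases "q = 1")
    case True
    then have [simp]: "\<mu> = L" using \<mu>L by (simp add: q_def)
    have "g (zz (Suc k)) + L / 2 * (norm (zz (Suc k) - zs))\<^sup>2 \<le> g zs"
      using pg[OF zs, of k] half_norm_diff_expand[of L "zz (Suc k)" zs "yy k"]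
      unfolding \<open>\<mu> = L\<close> by linarith
    moreover have "0 \<le> L / 2 * (norm (zz (Suc k) - zs))\<^sup>2" using L by simp
    ultimately have "g (zz (Suc k)) - g zs \<le> 0" by linarith
    also have "0 \<le> (1 - 1 / sqrt (L / \<mu>)) ^ k * (L / 2 * (norm (z0 - zs))\<^sup>2)"
      using L by simp
    finally show ?thesis by (simp add: zz_def)
  next
    case False
    then have q: "1 < q" using \<mu>L by (simp add: q_def)
    define \<rho> where "\<rho> = 1 - 1 / sqrt q"
    have \<rho>: "0 \<le> \<rho>" using q by (simp add: \<rho>_def)
    define V where "V k = g (zz (Suc k)) - g zs
      + L * (theta q k)\<^sup>2 / 2 * (norm (vv (Suc k) - zs))\<^sup>2" for k
    have th_pos: "0 < theta q k" for k
      using theta_properties(1)[OF q, of k] q by (smt (verit) divide_nonneg_nonneg real_sqrt_ge_zero)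
    have Vge: "g (zz (Suc k)) - g zs \<le> V k" for k
      using L by (simp add: V_def)
    \<comment> \<open>As \<open>\<gamma>\<^sub>0 = 0\<close> and \<open>\<theta>\<^sub>0 = 1\<close>, the first step starts at \<open>y = z0\<close> and ends with \<open>v = z\<close>.\<close>
    have V0: "V 0 \<le> L / 2 * (norm (z0 - zs))\<^sup>2"
    proof -
      have y0: "yy 0 = z0" by (simp add: yy_def zz0 theta_prev_def)
      have v1: "vv (Suc 0) = zz (Suc 0)" by (simp add: vvS)
      have "L / 2 * (norm (zz (Suc 0) - zs))\<^sup>2 = L / 2 * (norm (z0 - zz (Suc 0)))\<^sup>2
          + L * ((z0 - zz (Suc 0)) \<bullet> (zs - z0)) + L / 2 * (norm (z0 - zs))\<^sup>2"
        using half_norm_diff_expand[of L "zz (Suc 0)" zs z0] by (simp add: norm_minus_commute)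
      moreover have "0 \<le> \<mu> / 2 * (norm (zs - z0))\<^sup>2" using \<mu>L by simp
      moreover have "V 0 = g (zz (Suc 0)) - g zs + L / 2 * (norm (zz (Suc 0) - zs))\<^sup>2"
        by (simp add: V_def v1)
      ultimately show ?thesis
        using pg[OF zs, of 0] unfolding y0 by linarith
    qed
    have Vstep: "V (Suc k) \<le> \<rho> * V k" for k
    proof -
      define \<theta> where "\<theta> = theta q (Suc k)"
      have \<theta>: "0 < \<theta>" "\<theta> \<le> 1" "1 - \<theta> \<le> \<rho>"
        using th_pos[of "Suc k"] theta_properties(1,2)[OF q, of "Suc k"]
        unfolding \<theta>_def \<rho>_def by linarith+
      have \<gamma>': "L * \<theta>\<^sup>2 = (1 - \<theta>) * ((theta q k)\<^sup>2 * L) + \<theta> * \<mu>"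
      proof -
        have "L * \<theta>\<^sup>2 = L * ((1 - \<theta>) * (theta q k)\<^sup>2 + \<theta> / q)"
          using theta_properties(3)[OF q, of k] by (simp add: \<theta>_def)
        also have "\<dots> = (1 - \<theta>) * ((theta q k)\<^sup>2 * L) + \<theta> * (L / q)" by (simp add: algebra_simps)
        finally show ?thesis using \<mu>L L by (simp add: q_def)
      qed
      have "V (Suc k) \<le> (1 - \<theta>) * (g (zz (Suc k)) - g zs
          + (theta q k)\<^sup>2 * L / 2 * (norm (vv (Suc k) - zs))\<^sup>2)"
        unfolding V_def \<theta>_def[symmetric]
      proof (rule apgm_lyapunov_step[OF \<theta>(1,2) _ \<mu>L(1) L \<gamma>' _ _ pg[OF zs] pg[OF zzZ]])
        show "yy (Suc k) = zz (Suc k) + (\<theta> * ((theta q k)\<^sup>2 * L)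
            / ((theta q k)\<^sup>2 * L + \<mu> * \<theta>)) *\<^sub>R (vv (Suc k) - zz (Suc k))"
          by (simp only: yy_def \<theta>_def theta_prev_def nat.case)
        show "vv (Suc (Suc k)) = zz (Suc k) + inverse \<theta> *\<^sub>R (zz (Suc (Suc k)) - zz (Suc k))"
          by (simp only: vvS[of "Suc k"] \<theta>_def)
      qed (use L in simp)
      also have "\<dots> = (1 - \<theta>) * V k" by (simp add: V_def mult.commute)
      also have "\<dots> \<le> \<rho> * V k"
        using \<theta>(3) Vge[of k] min[OF zzZ, of "Suc k"] by (intro mult_right_mono) auto
      finally show ?thesis .
    qed
    have "V k \<le> \<rho> ^ k * (L / 2 * (norm (z0 - zs))\<^sup>2)"
    proof (induction k)
      case (Suc k)
      have "V (Suc k) \<le> \<rho> * V k" by (rule Vstep)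
      also have "\<dots> \<le> \<rho> * (\<rho> ^ k * (L / 2 * (norm (z0 - zs))\<^sup>2))"
        using Suc \<rho> by (rule mult_left_mono)
      finally show ?case by simp
    qed (use V0 in simp)
    then show ?thesis using Vge[of k] by (simp add: zz_def \<rho>_def q_def)
  qed
qed

section \<open>Quadratic programs with positive definite Hessian\<close>

definition quad :: "real^'n^'n \<Rightarrow> real^'n \<Rightarrow> real \<Rightarrow> real^'n \<Rightarrow> real" where
  "quad H b c w = w \<bullet> (H *v w) + 2 * (b \<bullet> w) + c"

lemma quad_expand:
  assumes "spd H"
  shows "quad H b c w = quad H b c y + (2 *\<^sub>R (H *v y + b)) \<bullet> (w - y) + (w - y) \<bullet> (H *v (w - y))"
proof -
  have "w \<bullet> (H *v y) = y \<bullet> (H *v w)"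
    using symmetric_inner_matrix[OF spd_symmetric[OF assms], of w y] by (simp add: inner_commute)
  then show ?thesis
    by (simp add: quad_def matrix_vector_mult_diff_distrib inner_diff_left inner_diff_right
        inner_add_left inner_commute[of "H *v y"] algebra_simps)
qed

lemma GDERIV_quad:
  assumes "spd H"
  shows "GDERIV (quad H b c) y :> 2 *\<^sub>R (H *v y + b)"
proof -
  have "(quad H b c has_derivative (\<lambda>h. y \<bullet> (H *v h) + h \<bullet> (H *v y) + 2 * (b \<bullet> h))) (at y)"
    unfolding quad_def[abs_def]
    by (auto intro!: derivative_eq_intros bounded_linear_imp_has_derivative
        matrix_vector_mul_bounded_linear)
  moreover have "(\<lambda>h. y \<bullet> (H *v h) + h \<bullet> (H *v y) + 2 * (b \<bullet> h)) = (\<lambda>h. h \<bullet> (2 *\<^sub>R (H *v y + b)))"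
    using symmetric_inner_matrix[OF spd_symmetric[OF assms], of y]
    by (auto simp: inner_add_right inner_commute)
  ultimately show ?thesis by (simp add: gderiv_def)
qed

text \<open>The quadratic is coercive with modulus \<open>lam_min H\<close>, so a minimizer over the part of \<open>Z\<close>
  in a large enough ball is a minimizer over \<open>Z\<close>.\<close>

lemma quad_minimizer_exists:
  assumes H: "spd H" and Z: "closed Z" "Z \<noteq> {}"
  shows "\<exists>s\<in>Z. \<forall>w\<in>Z. quad H b c s \<le> quad H b c w"
proof -
  obtain z0 where z0: "z0 \<in> Z" using Z by blast
  define \<mu> where "\<mu> = lam_min H"
  have \<mu>: "0 < \<mu>" using spd_eigenvalues(1)[OF H] by (simp add: \<mu>_def)
  define K where "K = \<bar>quad H b c z0 - c\<bar>"
  define r where "r = max (norm z0) ((2 * norm b + K) / \<mu> + 1)"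
  have out: "quad H b c z0 \<le> quad H b c w" if "r < norm w" for w
  proof -
    have w: "(2 * norm b + K) / \<mu> + 1 < norm w" using that by (simp add: r_def)
    have "0 \<le> (2 * norm b + K) / \<mu>" using \<mu> by (simp add: K_def)
    then have w1: "1 \<le> norm w" using w by linarith
    have "(2 * norm b + K) / \<mu> < norm w" using w by linarith
    then have "K \<le> \<mu> * norm w - 2 * norm b" using \<mu> by (simp add: field_simps)
    then have "1 * K \<le> norm w * (\<mu> * norm w - 2 * norm b)"
      using w1 by (intro mult_mono) (auto simp: K_def)
    also have "\<dots> = \<mu> * (norm w)\<^sup>2 - 2 * (norm b * norm w)"
      by (simp add: power2_eq_square algebra_simps)
    also have "\<dots> \<le> w \<bullet> (H *v w) + 2 * (b \<bullet> w)"
      using rayleigh_bounds(1)[OF spd_symmetric[OF H], of w] Cauchy_Schwarz_ineq2[of b w]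
      by (simp add: \<mu>_def abs_le_iff)
    finally show ?thesis by (simp add: quad_def K_def)
  qed
  have "\<exists>s\<in>Z \<inter> cball 0 r. \<forall>w\<in>Z \<inter> cball 0 r. quad H b c s \<le> quad H b c w"
  proof (rule continuous_attains_inf)
    show "compact (Z \<inter> cball 0 r)" using Z by (simp add: closed_Int_compact)
    show "Z \<inter> cball 0 r \<noteq> {}" using z0 by (auto simp: r_def)
    show "continuous_on (Z \<inter> cball 0 r) (quad H b c)"
      unfolding quad_def[abs_def]
      by (intro continuous_intros linear_continuous_on matrix_vector_mul_bounded_linear)
  qed
  then obtain s where s: "s \<in> Z" "\<And>w. w \<in> Z \<Longrightarrow> norm w \<le> r \<Longrightarrow> quad H b c s \<le> quad H b c w"
    by auto
  have "quad H b c s \<le> quad H b c z0" using s z0 by (simp add: r_def)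
  then show ?thesis
    using s out by (metis not_le order.trans)
qed

text \<open>If the slope \<open>p\<close> towards \<open>w\<close> were negative, a short enough step \<open>t\<close> in that direction, which
  stays in \<open>Z\<close> by convexity, would decrease the value.\<close>

lemma quad_variational_inequality:
  assumes H: "spd H" and Z: "convex Z" and s: "s \<in> Z" "\<And>w. w \<in> Z \<Longrightarrow> quad H b c s \<le> quad H b c w"
    and w: "w \<in> Z"
  shows "0 \<le> (H *v s + b) \<bullet> (w - s)"
proof (rule ccontr)
  define p where "p = (H *v s + b) \<bullet> (w - s)"
  define D where "D = (w - s) \<bullet> (H *v (w - s))"
  assume "\<not> 0 \<le> (H *v s + b) \<bullet> (w - s)"
  then have p: "p < 0" by (simp add: p_def)
  have D: "0 \<le> D" unfolding D_def by (rule spd_nonneg[OF H])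
  define t where "t = min 1 (- p / (D + 1))"
  have t: "0 < t" "t \<le> 1" using p D by (simp_all add: t_def divide_neg_pos)
  have "s + t *\<^sub>R (w - s) = (1 - t) *\<^sub>R s + t *\<^sub>R w" by (simp add: algebra_simps)
  then have "s + t *\<^sub>R (w - s) \<in> Z" using convexD[OF Z s(1) w, of "1 - t" t] t by simp
  then have "quad H b c s \<le> quad H b c (s + t *\<^sub>R (w - s))" by (rule s(2))
  also have "\<dots> = quad H b c s + t * (2 * p + t * D)"
    unfolding quad_expand[OF H, of b c "s + t *\<^sub>R (w - s)" s]
    by (simp add: p_def D_def matrix_vector_mult_scaleR algebra_simps)
  finally have "0 \<le> 2 * p + t * D" using t by (simp add: zero_le_mult_iff)
  moreover have "t * D \<le> - p"
  proof -
    have "t * D \<le> - p / (D + 1) * D" using D by (intro mult_right_mono) (auto simp: t_def)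
    also have "\<dots> \<le> - p" using p D by (simp add: field_simps)
    finally show ?thesis .
  qed
  ultimately show False using p by linarith
qed

lemma quad_growth:
  assumes H: "spd H" and Z: "convex Z" and s: "s \<in> Z" "\<And>w. w \<in> Z \<Longrightarrow> quad H b c s \<le> quad H b c w"
    and w: "w \<in> Z"
  shows "(wnorm H (w - s))\<^sup>2 \<le> quad H b c w - quad H b c s"
  using quad_variational_inequality[OF assms] quad_expand[OF H, of b c w s]
  by (simp add: wnorm_power2[OF H])

lemma minimizer_quad:
  assumes H: "spd H" and Z: "closed Z" "convex Z" "Z \<noteq> {}"
  shows "minimizer (quad H b c) Z \<in> Z"
    and "w \<in> Z \<Longrightarrow> quad H b c (minimizer (quad H b c) Z) \<le> quad H b c w"
proof -
  obtain s where s: "s \<in> Z" "\<And>w. w \<in> Z \<Longrightarrow> quad H b c s \<le> quad H b c w"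
    using quad_minimizer_exists[OF H Z(1,3)] by blast
  have "minimizer (quad H b c) Z = s"
    unfolding minimizer_def
  proof (rule the_equality)
    show "is_arg_min (quad H b c) (\<lambda>z. z \<in> Z) s"
      using s by (auto simp: is_arg_min_linorder)
    fix s' assume "is_arg_min (quad H b c) (\<lambda>z. z \<in> Z) s'"
    then have s': "s' \<in> Z" "quad H b c s' \<le> quad H b c s"
      using s by (auto simp: is_arg_min_linorder)
    have "(wnorm H (s' - s))\<^sup>2 \<le> 0" using quad_growth[OF H Z(2) s s'(1)] s'(2) by linarith
    then have "(s' - s) \<bullet> (H *v (s' - s)) \<le> 0" by (simp add: wnorm_power2[OF H])
    then show "s' = s" using H by (metis eq_iff_diff_eq_0 not_le spd_def)
  qed
  then show "minimizer (quad H b c) Z \<in> Z"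
    and "w \<in> Z \<Longrightarrow> quad H b c (minimizer (quad H b c) Z) \<le> quad H b c w"
    using s by auto
qed

text \<open>Each minimizer is tested against the other in its variational inequality. The sum of the two
  bounds \<open>\<parallel>s - s'\<parallel>\<^sub>H\<^sup>2\<close> by \<open>(b' - b) \<bullet> (s - s')\<close>, to which the Cauchy-Schwarz inequality for the
  dual pair of norms applies.\<close>

lemma minimizer_quad_lipschitz:
  assumes H: "spd H" and Z: "closed Z" "convex Z" "Z \<noteq> {}"
  shows "wnorm H (minimizer (quad H b c) Z - minimizer (quad H b' c') Z)
    \<le> wnorm (matrix_inv H) (b' - b)"
proof -
  define s s' where "s = minimizer (quad H b c) Z" and "s' = minimizer (quad H b' c') Z"
  define d where "d = s - s'"
  note m = minimizer_quad[OF H Z, where b = b and c = c, folded s_def]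
  note m' = minimizer_quad[OF H Z, where b = b' and c = c', folded s'_def]
  have "0 \<le> (H *v s + b) \<bullet> (s' - s)"
    by (rule quad_variational_inequality[OF H Z(2) m m'(1)])
  moreover have "0 \<le> (H *v s' + b') \<bullet> (s - s')"
    by (rule quad_variational_inequality[OF H Z(2) m' m(1)])
  ultimately have "d \<bullet> (H *v d) \<le> (b' - b) \<bullet> d"
    by (simp add: d_def matrix_vector_mult_diff_distrib inner_diff_left inner_diff_right
        inner_add_left inner_commute algebra_simps)
  also have "\<dots> \<le> wnorm (matrix_inv H) (b' - b) * wnorm H d"
    by (rule spd_dual_Cauchy_Schwarz[OF H])
  finally have sq: "wnorm H d * wnorm H d \<le> wnorm (matrix_inv H) (b' - b) * wnorm H d"
    by (simp add: wnorm_power2[OF H, symmetric] power2_eq_square)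
  show ?thesis
  proof (cases "wnorm H d = 0")
    case True
    then show ?thesis
      using wnorm_nonneg[OF H] by (simp add: wnorm_matrix_inv[OF H] d_def s_def s'_def)
  next
    case False
    then have "0 < wnorm H d" using wnorm_nonneg[OF H, of d] by simp
    then show ?thesis using sq by (simp add: d_def s_def s'_def)
  qed
qed

text \<open>The convergence bound is for the objective gap in terms of the Euclidean distance. Quadratic
  growth turns the gap into the squared \<open>H\<close>-distance on the left, and \<open>lam_max H = \<kappa> lam_min H\<close>
  turns the Euclidean distance into \<open>\<kappa>\<close> times the squared \<open>H\<close>-distance on the right.\<close>

lemma apgm_quad_contraction:
  fixes Z :: "(real^'n) set" and b :: "real^'n" and c :: real
  assumes H: "spd H" and Z: "closed Z" "convex Z" and z0: "z0 \<in> Z"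
  defines "s \<equiv> minimizer (quad H b c) Z"
  shows "wnorm H (fst (apgm Z (quad H b c) (2 * lam_min H) (2 * lam_max H) z0 (Suc k)) - s)
    \<le> sqrt (kappa H * (1 - 1 / sqrt (kappa H)) ^ k) * wnorm H (z0 - s)"
proof -
  define zk where "zk = fst (apgm Z (quad H b c) (2 * lam_min H) (2 * lam_max H) z0 (Suc k))"
  define \<rho> where "\<rho> = 1 - 1 / sqrt (kappa H)"
  note lam = spd_eigenvalues[OF H]
  have \<kappa>: "1 \<le> kappa H" using lam by (simp add: kappa_def)
  have \<rho>: "0 \<le> \<rho>" using \<kappa> by (simp add: \<rho>_def)
  have ne: "Z \<noteq> {}" using z0 by blast
  note s = minimizer_quad[OF H Z ne, where b = b and c = c, folded s_def]
  note bounds = rayleigh_bounds[OF spd_symmetric[OF H]]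
  have zk: "zk \<in> Z" unfolding zk_def by (rule apgm_in_set[OF Z(1) z0])
  have "(wnorm H (zk - s))\<^sup>2 \<le> quad H b c zk - quad H b c s"
    by (rule quad_growth[OF H Z(2) s zk])
  also have "\<dots> \<le> (1 - 1 / sqrt (2 * lam_max H / (2 * lam_min H))) ^ k
      * (2 * lam_max H / 2 * (norm (z0 - s))\<^sup>2)"
    unfolding zk_def
  proof (rule apgm_convergence[OF Z z0 s(1) _ _ GDERIV_quad[OF H] _ _ s(2)])
    fix w y
    show "quad H b c y + 2 *\<^sub>R (H *v y + b) \<bullet> (w - y) + 2 * lam_min H / 2 * (norm (w - y))\<^sup>2
        \<le> quad H b c w"
      using quad_expand[OF H, of b c w y] bounds(1)[of "w - y"] by simp
    show "quad H b c w
        \<le> quad H b c y + 2 *\<^sub>R (H *v y + b) \<bullet> (w - y) + 2 * lam_max H / 2 * (norm (w - y))\<^sup>2"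
      using quad_expand[OF H, of b c w y] bounds(2)[of "w - y"] by simp
  qed (use lam in auto)
  also have "\<dots> = \<rho> ^ k * (kappa H * (lam_min H * (norm (z0 - s))\<^sup>2))"
    using lam by (simp add: \<rho>_def kappa_def)
  also have "\<dots> \<le> \<rho> ^ k * (kappa H * (wnorm H (z0 - s))\<^sup>2)"
    using \<rho> \<kappa> bounds(1)[of "z0 - s"] by (intro mult_left_mono) (auto simp: wnorm_power2[OF H])
  finally have "sqrt ((wnorm H (zk - s))\<^sup>2) \<le> sqrt (kappa H * \<rho> ^ k * (wnorm H (z0 - s))\<^sup>2)"
    by (intro real_sqrt_le_mono) (simp add: mult_ac)
  then show ?thesis
    using wnorm_nonneg[OF H] by (simp add: real_sqrt_mult zk_def \<rho>_def)
qed

section \<open>The condensed optimal control problem\<close>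

lemma sum_over_pairs:
  fixes F :: "'i::finite \<times> 'a::finite \<Rightarrow> 'b::comm_monoid_add"
  shows "(\<Sum>p\<in>UNIV. F p) = (\<Sum>i\<in>UNIV. \<Sum>a\<in>UNIV. F (i, a))"
  by (simp add: UNIV_Times_UNIV[symmetric] sum.cartesian_product del: UNIV_Times_UNIV)

definition block_diag :: "('i \<Rightarrow> real^'a^'a) \<Rightarrow> real^('i::finite \<times> 'a)^('i \<times> 'a)" where
  "block_diag D = (\<chi> p q. if fst p = fst q then D (fst p) $ snd p $ snd q else 0)"

definition block :: "real^('i::finite \<times> 'a) \<Rightarrow> 'i \<Rightarrow> real^'a" where
  "block w i = (\<chi> a. w $ (i, a))"

lemma block_diag_form:
  "w \<bullet> (block_diag D *v w) = (\<Sum>i\<in>UNIV. block w i \<bullet> (D i *v block w i))"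
proof -
  have "(block_diag D *v w) $ (i, a) = (D i *v block w i) $ a" for i a
  proof -
    have "(block_diag D *v w) $ (i, a)
        = (\<Sum>j\<in>UNIV. \<Sum>b\<in>UNIV. (if i = j then D i $ a $ b else 0) * w $ (j, b))"
      by (simp add: matrix_vector_mult_def sum_over_pairs block_diag_def cong: if_cong)
    also have "\<dots> = (\<Sum>j\<in>UNIV. if i = j then \<Sum>b\<in>UNIV. D i $ a $ b * w $ (j, b) else 0)"
      by (intro sum.cong) auto
    finally show ?thesis by (simp add: matrix_vector_mult_def block_def)
  qed
  then show ?thesis by (simp add: inner_vec_def sum_over_pairs block_def)
qed

lemma transpose_block_diag: "transpose (block_diag D) = block_diag (\<lambda>i. transpose (D i))"
  by (auto simp: block_diag_def transpose_def vec_eq_iff)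

lemma spd_block_diag:
  assumes D: "\<And>i. spd (D i)"
  shows "spd (block_diag D)"
  unfolding spd_def
proof (intro conjI allI impI)
  show "transpose (block_diag D) = block_diag D"
    using D by (simp add: transpose_block_diag spd_def)
  fix w :: "real^('a \<times> 'b)" assume "w \<noteq> 0"
  then obtain i where i: "block w i \<noteq> 0"
    by (auto simp: vec_eq_iff block_def)
  have "0 < block w i \<bullet> (D i *v block w i)" using D[of i] i by (simp add: spd_def)
  also have "\<dots> \<le> (\<Sum>i\<in>UNIV. block w i \<bullet> (D i *v block w i))"
    using spd_nonneg[OF D] by (intro member_le_sum) auto
  finally show "0 < w \<bullet> (block_diag D *v w)" by (simp add: block_diag_form)
qed

lemma kron_mat_1: "kron (mat 1) R = block_diag (\<lambda>_. R)"
  by (auto simp: kron_def block_diag_def mat_def vec_eq_iff)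

lemma H_hat_block_diag: "H_hat Q P = block_diag (\<lambda>i. case i of Some _ \<Rightarrow> Q | None \<Rightarrow> P)"
  by (simp add: H_hat_def block_diag_def)

lemma spd_H_hat: "spd Q \<Longrightarrow> spd P \<Longrightarrow> spd (H_hat Q P)"
  unfolding H_hat_block_diag by (intro spd_block_diag) (simp split: option.split)

lemma spd_kron_mat_1: "spd R \<Longrightarrow> spd (kron (mat 1) R)"
  unfolding kron_mat_1 by (intro spd_block_diag)

lemma spd_H_mat:
  fixes Q :: "real^'n^'n" and R :: "real^'m^'m"
  assumes "spd Q" "spd P" "spd R"
  shows "spd (H_mat A B Q R P :: real^('h::{finite,linorder} \<times> 'm)^('h \<times> 'm))"
proof -
  have Hh: "spd (H_hat Q P :: real^('h option \<times> 'n)^('h option \<times> 'n))"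
    using assms by (intro spd_H_hat)
  have Rh: "spd (kron (mat 1) R :: real^('h \<times> 'm)^('h \<times> 'm))"
    using assms by (intro spd_kron_mat_1)
  show ?thesis
    unfolding spd_def
  proof (intro conjI allI impI)
    have add: "transpose (X + Y) = transpose X + transpose Y" for X Y :: "real^'x^'y"
      by (simp add: transpose_def vec_eq_iff)
    show "transpose (H_mat A B Q R P) = (H_mat A B Q R P :: real^('h \<times> 'm)^('h \<times> 'm))"
      using spd_symmetric[OF Hh] spd_symmetric[OF Rh]
      by (simp add: H_mat_def add matrix_transpose_mul transpose_transpose matrix_mul_assoc)
    fix w :: "real^('h \<times> 'm)" assume w: "w \<noteq> 0"
    have "0 \<le> (B_hat A B *v w) \<bullet> (H_hat Q P *v (B_hat A B *v w))" by (rule spd_nonneg[OF Hh])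
    moreover have "0 < w \<bullet> (kron (mat 1) R *v w)" using Rh w by (simp add: spd_def)
    moreover have "w \<bullet> (H_mat A B Q R P *v w)
        = (B_hat A B *v w) \<bullet> (H_hat Q P *v (B_hat A B *v w)) + w \<bullet> (kron (mat 1) R *v w)"
      by (simp add: H_mat_def matrix_vector_mult_add_rdistrib inner_add_right
          matrix_vector_mul_assoc[symmetric] inner_transpose_matrix del: transpose_matrix_vector)
    ultimately show "0 < w \<bullet> (H_mat A B Q R P *v w)" by linarith
  qed
qed

lemma sum_over_plus:
  fixes F :: "'a::finite + 'b::finite \<Rightarrow> 'c::comm_monoid_add"
  shows "(\<Sum>p\<in>UNIV. F p) = (\<Sum>a\<in>UNIV. F (Inl a)) + (\<Sum>b\<in>UNIV. F (Inr b))"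
  by (simp add: UNIV_Plus_UNIV[symmetric] sum.Plus del: UNIV_Plus_UNIV)

lemma block_mat_form:
  "stack z x \<bullet> (block_mat X Y (transpose Y) W *v stack z x)
    = z \<bullet> (X *v z) + 2 * ((Y *v x) \<bullet> z) + x \<bullet> (W *v x)"
proof -
  have "block_mat X Y Y' W *v stack z x = stack (X *v z + Y *v x) (Y' *v z + W *v x)" for Y'
    by (auto simp: vec_eq_iff matrix_vector_mult_def block_mat_def stack_def sum_over_plus
        split: sum.split)
  moreover have "stack z x \<bullet> stack u v = z \<bullet> u + x \<bullet> v" for u v
    by (simp add: inner_vec_def stack_def sum_over_plus)
  ultimately show ?thesis
    by (simp add: inner_add_right inner_transpose_matrix inner_commute[of z "Y *v x"] del: transpose_matrix_vector)
qed

text \<open>The cost is defined as the square of a square root, which equals the form of \<open>M\<close> only where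
  that form is nonnegative. It is, because it equals the form of \<open>H_hat\<close> at the predicted
  trajectory \<open>B_hat w + A_hat x\<close> plus the input cost.\<close>

lemma cost_eq_quad:
  fixes x :: "real^'n" and B :: "real^'m^'n"
  assumes "spd Q" "spd P" "spd R"
  shows "\<exists>c. (\<lambda>w :: real^('h::{finite,linorder} \<times> 'm). cost A B Q R P w x)
    = quad (H_mat A B Q R P) (G_mat A B Q P *v x) c"
proof -
  let ?Hh = "H_hat Q P :: real^('h option \<times> 'n)^('h option \<times> 'n)"
  have Hh: "spd ?Hh"
    using assms by (intro spd_H_hat)
  have Rh: "spd (kron (mat 1) R :: real^('h \<times> 'm)^('h \<times> 'm))"
    using assms by (intro spd_kron_mat_1)
  have nonneg: "0 \<le> stack w x \<bullet> (M_mat A B Q R P *v stack w x)" for w :: "real^('h \<times> 'm)"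
  proof -
    define u where "u = (B_hat A B :: real^('h \<times> 'm)^('h option \<times> 'n)) *v w"
    define v where "v = (A_hat A :: real^'n^('h option \<times> 'n)) *v x"
    have "stack w x \<bullet> (M_mat A B Q R P *v stack w x)
      = (u + v) \<bullet> (?Hh *v (u + v)) + w \<bullet> (kron (mat 1) R *v w)"
      unfolding M_mat_def block_mat_form
      using symmetric_inner_matrix[OF spd_symmetric[OF Hh], of v u]
      by (simp add: H_mat_def G_mat_def W_mat_def matrix_vector_mult_add_rdistrib inner_add_right
          inner_add_left matrix_vector_right_distrib inner_commute
          matrix_vector_mul_assoc[symmetric] inner_transpose_matrix u_def v_def
          del: transpose_matrix_vector)
    then show ?thesis using spd_nonneg[OF Hh] spd_nonneg[OF Rh] by simp
  qed
  have "cost A B Q R P w x = quad (H_mat A B Q R P) (G_mat A B Q P *v x)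
      (x \<bullet> (W_mat TYPE('h) A Q P *v x)) w" for w :: "real^('h \<times> 'm)"
    using nonneg[of w]
    by (simp add: cost_def wnorm_def) (simp add: M_mat_def block_mat_form quad_def)
  then show ?thesis by blast
qed

lemma closed_feasible:
  fixes U :: "(real^'m) set"
  assumes "closed U" shows "closed (feasible U :: (real^('h::finite \<times> 'm)) set)"
proof -
  have "closed ((\<lambda>z :: real^('h \<times> 'm). \<chi> a. z $ (j, a)) -` U)" for j
    using assms by (intro closed_vimage continuous_intros continuous_on_vec_lambda)
  then have "closed (\<Inter>j. (\<lambda>z :: real^('h \<times> 'm). \<chi> a. z $ (j, a)) -` U)" by blast
  moreover have "feasible U = (\<Inter>j. (\<lambda>z :: real^('h \<times> 'm). \<chi> a. z $ (j, a)) -` U)"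
    by (auto simp: feasible_def)
  ultimately show ?thesis by simp
qed

lemma convex_feasible:
  fixes U :: "(real^'m) set"
  assumes "convex U" shows "convex (feasible U :: (real^('h::finite \<times> 'm)) set)"
proof (rule convexI)
  fix x y :: "real^('h \<times> 'm)" and u v :: real
  assume xy: "x \<in> feasible U" "y \<in> feasible U" and uv: "0 \<le> u" "0 \<le> v" "u + v = 1"
  have "(\<chi> a. (u *\<^sub>R x + v *\<^sub>R y) $ (j, a)) = u *\<^sub>R (\<chi> a. x $ (j, a)) + v *\<^sub>R (\<chi> a. y $ (j, a))" for j
    by (simp add: vec_eq_iff)
  then show "u *\<^sub>R x + v *\<^sub>R y \<in> feasible U"
    using xy uv assms by (simp add: feasible_def convexD)
qed

section \<open>Scalar recursions with decay\<close>

lemma decay_recursion_bound: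
  fixes a d :: "nat \<Rightarrow> real"
  assumes \<eta>: "0 \<le> \<eta>" "\<eta> < 1" and rec: "\<And>k. a (Suc k) \<le> \<eta> * (a k + d k)"
    and d: "\<And>k. d k \<le> c" and c: "0 \<le> c"
  shows "a k \<le> \<eta> ^ k * a 0 + \<eta> / (1 - \<eta>) * c"
proof (induction k)
  case (Suc k)
  have "a (Suc k) \<le> \<eta> * (a k + d k)" by (rule rec)
  also have "\<dots> \<le> \<eta> * ((\<eta> ^ k * a 0 + \<eta> / (1 - \<eta>) * c) + c)"
    using Suc d[of k] \<eta> by (intro mult_left_mono add_mono) auto
  also have "\<dots> = \<eta> ^ Suc k * a 0 + \<eta> / (1 - \<eta>) * c"
    using \<eta> by (simp add: field_simps)
  finally show ?case .
qed (use \<eta> c in simp)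

text \<open>The supremum may be infinite. If \<open>\<eta> > 0\<close> the bound is then trivial; if \<open>\<eta> = 0\<close> the product
  \<open>0 * \<infinity>\<close> is 0, and the bound holds since \<open>a\<close> is nonpositive after the first step.\<close>

lemma decay_recursion_ISS:
  fixes a d :: "nat \<Rightarrow> real"
  assumes \<eta>: "0 \<le> \<eta>" "\<eta> < 1" and rec: "\<And>k. a (Suc k) \<le> \<eta> * (a k + d k)"
    and d: "\<And>k. 0 \<le> d k"
  shows "ereal (a k) \<le> ereal (\<eta> ^ k * a 0) + ereal (\<eta> / (1 - \<eta>)) * (SUP j. ereal (d j))"
proof (cases "\<eta> = 0")
  case True
  have "a (Suc j) \<le> 0" for j using rec[of j] True by simp
  then show ?thesis using True by (cases k) (auto simp: zero_ereal_def[symmetric])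
next
  case False
  define \<gamma> where "\<gamma> = \<eta> / (1 - \<eta>)"
  have pos: "0 < \<gamma>" using False \<eta> by (simp add: \<gamma>_def)
  show ?thesis
  proof (cases "SUP j. ereal (d j)")
    case (real c)
    have dc: "d j \<le> c" for j
      using SUP_upper[of j UNIV "\<lambda>j. ereal (d j)"] by (simp add: real)
    have "0 \<le> c" using d[of 0] dc[of 0] by linarith
    then show ?thesis
      using decay_recursion_bound[OF \<eta>, of a d c k] rec dc by (simp add: real)
  next
    case PInf
    have "ereal \<gamma> * \<infinity> = \<infinity>" using pos by simp
    then show ?thesis unfolding \<gamma>_def[symmetric] PInf by simp
  next
    case MInf
    then show ?thesis using SUP_upper[of 0 UNIV "\<lambda>j. ereal (d j)"] by simp
  qed
qed

text \<open>The recursion is restarted at an index beyond which \<open>d\<close> is at most its limit superior plus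
  \<open>\<epsilon>\<close>; the influence of the restart value fades geometrically.\<close>

lemma decay_recursion_limsup:
  fixes a d :: "nat \<Rightarrow> real"
  assumes \<eta>: "0 \<le> \<eta>" "\<eta> < 1" and rec: "\<And>k. a (Suc k) \<le> \<eta> * (a k + d k)"
    and d: "\<And>k. 0 \<le> d k"
  shows "limsup (\<lambda>k. ereal (a k)) \<le> ereal (\<eta> / (1 - \<eta>)) * limsup (\<lambda>k. ereal (d k))"
proof (cases "\<eta> = 0")
  case True
  have "a k \<le> 0" if "1 \<le> k" for k using rec[of "k - 1"] True that by simp
  then have "limsup (\<lambda>k. ereal (a k)) \<le> 0"
    by (intro Limsup_bounded) (auto simp: eventually_sequentially)
  then show ?thesis using True by (simp add: zero_ereal_def[symmetric])
next
  case False
  define \<gamma> where "\<gamma> = \<eta> / (1 - \<eta>)"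
  have \<gamma>: "0 < \<gamma>" using False \<eta> by (simp add: \<gamma>_def)
  have lim0: "0 \<le> limsup (\<lambda>k. ereal (d k))"
    using d by (intro le_Limsup) auto
  show ?thesis
  proof (cases "limsup (\<lambda>k. ereal (d k))")
    case (real D)
    have D: "0 \<le> D" using lim0 by (simp add: real)
    have "limsup (\<lambda>k. ereal (a k)) \<le> ereal (\<gamma> * D) + ereal e" if e: "0 < e" for e
    proof -
      define \<epsilon> where "\<epsilon> = e / (\<gamma> + 1)"
      have \<epsilon>: "0 < \<epsilon>" "\<gamma> * (D + \<epsilon>) + \<epsilon> = \<gamma> * D + e"
      proof -
        have "(\<gamma> + 1) * \<epsilon> = e" using \<gamma> by (simp add: \<epsilon>_def)
        then show "\<gamma> * (D + \<epsilon>) + \<epsilon> = \<gamma> * D + e" by (simp add: algebra_simps)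
      qed (use e \<gamma> in \<open>simp add: \<epsilon>_def\<close>)
      have "limsup (\<lambda>k. ereal (d k)) < ereal (D + \<epsilon>)" using \<epsilon> by (simp add: real)
      from Limsup_lessD[OF this] obtain K where "\<And>k. k \<ge> K \<Longrightarrow> d k < D + \<epsilon>"
        by (auto simp: eventually_sequentially)
      then have K: "\<And>k. k \<ge> K \<Longrightarrow> d k \<le> D + \<epsilon>" by (simp add: less_imp_le)
      have tail: "a (K + j) \<le> \<eta> ^ j * a K + \<gamma> * (D + \<epsilon>)" for j
        unfolding \<gamma>_def
        using decay_recursion_bound[OF \<eta>, of "\<lambda>j. a (K + j)" "\<lambda>j. d (K + j)" "D + \<epsilon>" j] rec K D \<epsilon>
        by simp
      have "(\<lambda>j. \<eta> ^ j * a K) \<longlonglongrightarrow> 0 * a K"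
        using \<eta> by (intro tendsto_intros LIMSEQ_realpow_zero) auto
      then have "eventually (\<lambda>j. \<eta> ^ j * a K < \<epsilon>) sequentially"
        using \<epsilon> by (intro order_tendstoD(2)) auto
      then obtain J where J: "\<And>j. j \<ge> J \<Longrightarrow> \<eta> ^ j * a K < \<epsilon>"
        by (auto simp: eventually_sequentially)
      have "a k \<le> \<gamma> * D + e" if "k \<ge> K + J" for k
      proof -
        have "\<eta> ^ (k - K) * a K < \<epsilon>" using that by (intro J) simp
        then show ?thesis using tail[of "k - K"] \<epsilon>(2) that by simp
      qed
      then have "limsup (\<lambda>k. ereal (a k)) \<le> ereal (\<gamma> * D + e)"
        by (intro Limsup_bounded) (auto simp: eventually_sequentially)
      then show ?thesis by simp
    qed
    then have "limsup (\<lambda>k. ereal (a k)) \<le> ereal (\<gamma> * D)"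
      by (metis ereal_le_epsilon2)
    then show ?thesis by (simp add: real \<gamma>_def)
  next
    case PInf
    have "ereal \<gamma> * \<infinity> = \<infinity>" using \<gamma> by simp
    then show ?thesis unfolding \<gamma>_def[symmetric] PInf by simp
  next
    case MInf
    then show ?thesis using lim0 by simp
  qed
qed

section \<open>The contraction factor\<close>

text \<open>The exponent in \<open>eta_a\<close> is real and \<open>0 powr 0 = 0\<close>, whereas \<open>0 ^ 0 = 1\<close>; the second
  assumption excludes the only case where the two readings differ.\<close>

lemma eta_a_eq_sqrt:
  assumes q: "1 \<le> q" and k: "q = 1 \<Longrightarrow> 0 < k"
  shows "eta_a q (Suc k) = sqrt (q * (1 - 1 / sqrt q) ^ k)"
proof -
  define \<rho> where "\<rho> = 1 - 1 / sqrt q"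
  have \<rho>: "0 \<le> \<rho>" using q by (simp add: \<rho>_def)
  have "q powr (- 1 / 2) = 1 / sqrt q"
    using q powr_minus_divide[of q "1 / 2"] by (simp add: powr_half_sqrt)
  then have "eta_a q (Suc k) = sqrt q * \<rho> powr (real k / 2)"
    by (simp add: eta_a_def \<rho>_def)
  also have "\<rho> powr (real k / 2) = sqrt (\<rho> powr real k)"
    using \<rho> by (rule powr_half_sqrt_powr)
  also have "\<rho> powr real k = \<rho> ^ k"
  proof (cases "q = 1")
    case True
    then show ?thesis using k by (simp add: \<rho>_def)
  next
    case False
    then have "0 < \<rho>" using q by (simp add: \<rho>_def)
    then show ?thesis by (rule powr_realpow)
  qed
  finally show ?thesis by (simp add: real_sqrt_mult \<rho>_def)
qed

lemma contraction_factor_less_one: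
  assumes q: "1 \<le> q" and l: "l_bar q < real (Suc k)"
  shows "q * (1 - 1 / sqrt q) ^ k < 1"
proof (cases "q = 1")
  case True
  then show ?thesis using l by (cases k) (simp_all add: l_bar_def)
next
  case False
  define \<rho> where "\<rho> = 1 - 1 / sqrt q"
  have \<rho>: "0 < \<rho>" "\<rho> < 1" using q False by (simp_all add: \<rho>_def)
  have ln: "ln \<rho> < 0" using \<rho> by simp
  have "- (ln q / ln \<rho>) < real k" using l by (simp add: l_bar_def \<rho>_def)
  then have "real k * ln \<rho> < - ln q" using ln by (simp add: field_simps)
  then have "ln (q * \<rho> ^ k) < 0" using q \<rho> by (simp add: ln_mult ln_realpow)
  then show ?thesis using q \<rho> by (simp add: \<rho>_def[symmetric])
qed

section \<open>Input-to-state stability of the optimizer dynamics\<close>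

theorem theorem5:
  fixes A :: "real^'n^'n" and B :: "real^'m^'n"
    and Q P :: "real^'n^'n" and R :: "real^'m^'m"
    and U :: "(real^'m) set"
    and H :: "real^('h::{finite,linorder} \<times> 'm)^('h \<times> 'm)"
    and G :: "real^'n^('h \<times> 'm)"
    and Z :: "(real^('h \<times> 'm)) set"
    and f :: "real^('h \<times> 'm) \<Rightarrow> real^'n \<Rightarrow> real"
    and S :: "real^'n \<Rightarrow> real^('h \<times> 'm)"
    and l :: nat
    and x :: "nat \<Rightarrow> real^'n"
    and z e :: "nat \<Rightarrow> real^('h \<times> 'm)"
    and \<Delta>x :: "nat \<Rightarrow> real^'n"
  assumes "stabilizable A B"
    and "spd R" and "spd Q" and "spd P"
    and "riccati A B Q R P"
    and "closed U" and "convex U" and "0 \<in> interior U"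
    and H: "H = H_mat A B Q R P"
    and G: "G = G_mat A B Q P"
    and Z: "Z = feasible U"
    and f: "f = cost A B Q R P"
    and S: "\<And>\<xi>. S \<xi> = minimizer (\<lambda>w. f w \<xi>) Z"
    and "z 0 \<in> Z"
    and "\<And>k. k \<ge> 1 \<Longrightarrow> z k = optimizer_map H Z f l (z (k - 1)) (x k)"
    and e: "\<And>k. e k = z k - S (x k)"
    and \<Delta>x: "\<And>k. \<Delta>x k = x (k + 1) - x k"
    and "l > 0"
    and "real l > l_bar (kappa H)"
  shows "eta_a (kappa H) l < 1
    \<and> (\<forall>k. ereal (wnorm H (e k))
          \<le> ereal ((eta_a (kappa H) l) ^ k * wnorm H (e 0))
            + ereal (gamma2_a (kappa H) l) * (SUP j. ereal (wnorm (matrix_inv H) (G *v \<Delta>x j))))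
    \<and> limsup (\<lambda>k. ereal (wnorm H (e k)))
        \<le> ereal (gamma2_a (kappa H) l) * limsup (\<lambda>k. ereal (wnorm (matrix_inv H) (G *v \<Delta>x k)))"
proof -
  have H': "spd H" unfolding H by (rule spd_H_mat[OF \<open>spd Q\<close> \<open>spd P\<close> \<open>spd R\<close>])
  have \<kappa>: "1 \<le> kappa H"
    using spd_eigenvalues[OF H'] by (simp add: kappa_def)
  obtain j where l: "l = Suc j" using \<open>l > 0\<close> gr0_conv_Suc by blast
  define \<eta> where "\<eta> = eta_a (kappa H) l"
  \<comment> \<open>For \<open>kappa H = 1\<close> the iteration bound is 1, so at least two iterations are made.\<close>
  have j: "0 < j" if "kappa H = 1"
    using \<open>real l > l_bar (kappa H)\<close> that by (cases j) (simp_all add: l l_bar_def)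
  have \<eta>: "\<eta> = sqrt (kappa H * (1 - 1 / sqrt (kappa H)) ^ j)"
    unfolding \<eta>_def l by (rule eta_a_eq_sqrt[OF \<kappa> j])
  have \<eta>1: "\<eta> < 1"
    using contraction_factor_less_one[OF \<kappa>, of j] \<open>real l > l_bar (kappa H)\<close>
    by (simp add: \<eta> l)
  have \<eta>0: "0 \<le> \<eta>" unfolding \<eta> using \<kappa> by simp
  have Z': "closed Z" "convex Z"
    unfolding Z using closed_feasible[OF \<open>closed U\<close>] convex_feasible[OF \<open>convex U\<close>] .
  have ne: "Z \<noteq> {}" using \<open>z 0 \<in> Z\<close> by blast
  have "\<exists>c. \<forall>\<xi>. (\<lambda>w. f w \<xi>) = quad H (G *v \<xi>) (c \<xi>)"
    unfolding f H G by (intro choice allI cost_eq_quad \<open>spd Q\<close> \<open>spd P\<close> \<open>spd R\<close>)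
  then obtain c where fq: "\<And>\<xi>. (\<lambda>w. f w \<xi>) = quad H (G *v \<xi>) (c \<xi>)" by blast
  have zS: "z (Suc k) = optimizer_map H Z f l (z k) (x (Suc k))" for k
    using assms(15)[of "Suc k"] by simp
  have zZ: "z k \<in> Z" for k
  proof (induction k)
    case (Suc k)
    then show ?case unfolding zS optimizer_map_def by (rule apgm_in_set[OF Z'(1)])
  qed (rule \<open>z 0 \<in> Z\<close>)
  have S_lip: "wnorm H (S (x k) - S (x (Suc k))) \<le> wnorm (matrix_inv H) (G *v \<Delta>x k)" for k
    using minimizer_quad_lipschitz[OF H' Z' ne]
    by (simp add: S fq \<Delta>x matrix_vector_mult_diff_distrib)
  have contraction: "wnorm H (e (Suc k)) \<le> \<eta> * wnorm H (z k - S (x (Suc k)))" for k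
    unfolding e zS optimizer_map_def S fq \<eta> l by (rule apgm_quad_contraction[OF H' Z' zZ])
  have rec: "wnorm H (e (Suc k)) \<le> \<eta> * (wnorm H (e k) + wnorm (matrix_inv H) (G *v \<Delta>x k))" for k
  proof -
    have "z k - S (x (Suc k)) = e k + (S (x k) - S (x (Suc k)))" by (simp add: e)
    then have "wnorm H (z k - S (x (Suc k))) \<le> wnorm H (e k) + wnorm H (S (x k) - S (x (Suc k)))"
      using wnorm_triangle[OF H'] by metis
    also have "\<dots> \<le> wnorm H (e k) + wnorm (matrix_inv H) (G *v \<Delta>x k)"
      using S_lip by simp
    finally show ?thesis using contraction[of k] \<eta>0 by (meson mult_left_mono order_trans)
  qed
  have d: "0 \<le> wnorm (matrix_inv H) (G *v \<Delta>x k)" for k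
    using order_trans[OF wnorm_nonneg[OF H'] S_lip] .
  have \<gamma>: "gamma2_a (kappa H) l = \<eta> / (1 - \<eta>)" by (simp add: gamma2_a_def \<eta>_def)
  show ?thesis
    unfolding \<gamma> \<eta>_def[symmetric]
    using \<eta>1 decay_recursion_ISS[of \<eta> "\<lambda>k. wnorm H (e k)", OF \<eta>0 \<eta>1 rec d]
      decay_recursion_limsup[of \<eta> "\<lambda>k. wnorm H (e k)", OF \<eta>0 \<eta>1 rec d]
    by blast
qed

end
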